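(* Let $c\in\mathbb{R}$ and consider the Lagrangian on $\mathbb{T}^2=\mathbb{R}^2/\mathbb{Z}^2$ $$L_a(x,y,\dot x,\dot y)=\tfrac12\dot x^2+1-\cos(2\pi x)+\tfrac12(\dot y-c)^2 .$$ Then its Mañé critical value is $c(L_a)=0$, the set $\Gamma_a=\{0\}\times\mathbb{S}^1\times\{0\}\times\{c\}\subset T\mathbb{T}^2$ (in the coordinates $(x,y,\dot x,\dot y)$) is a hyperbolic periodic orbit of the Euler-Lagrange flow of $L_a$, and the Aubry set of $L_a$ is $\tilde{\mathcal A}_0=\Gamma_a$, so that it consists of only one hyperbolic periodic orbit. Moreover, there exist $u\in C(\mathbb{T}^2,\mathbb{R})$, a point $(x_0,y_0)\in\mathbb{T}^2$ and a sequence $\{t_n\}_{n=1}^{+\infty}$ with $t_n\to+\infty$ as $n\to+\infty$ such that $$\big|T^a_{t_n}u(x_0,y_0)-\bar u(x_0,y_0)\big|\ge O\Big(\frac{1}{t_n}\Big),\qquad n\to+\infty,$$ that is, for some constant $C>0$ the left-hand side is at least $C/t_n$ for all sufficiently large $n$; here $\bar u=\lim_{t\to+\infty}T^a_tu$. Thus, even though the Aubry set consists of one hyperbolic periodic orbit, the rate of convergence of the Lax-Oleinik semigroup $\{T^a_t\}_{t\ge0}$ of $L_a$ cannot be better than $O(1/t)$.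
   Context: Lax-Oleinik semigroup: for $t\ge0$ and $u\in C(\mathbb{T}^2,\mathbb{R})$, $$T^a_tu(q)=\inf_\gamma\Big\{u(\gamma(0))+\int_0^tL_a(\gamma(s),\dot\gamma(s))\,ds\Big\},\qquad q\in\mathbb{T}^2,$$ the infimum being over continuous piecewise $C^1$ paths $\gamma:[0,t]\to\mathbb{T}^2$ with $\gamma(t)=q$. By a theorem of Fathi, since $c(L_a)=0$, the uniform limit $\bar u=\lim_{t\to+\infty}T^a_tu$ exists for every $u\in C(\mathbb{T}^2,\mathbb{R})$. Mañé critical value: $c(L_a)=-\min_\mu\int L_a\,d\mu$ over Borel probability measures $\mu$ on $T\mathbb{T}^2$ invariant under the Euler-Lagrange flow. Aubry set (when $c(L_a)=0$): let $\Phi(q,q')=\inf\int_0^tL_a(\gamma,\dot\gamma)\,ds$ over all $t>0$ and continuous piecewise $C^1$ paths $\gamma:[0,t]\to\mathbb{T}^2$ from $q$ to $q'$. The Aubry set $\tilde{\mathcal A}_0\subset T\mathbb{T}^2$ is the union of the orbits $\{(\gamma(s),\dot\gamma(s)):s\in\mathbb{R}\}$ of curves $\gamma:\mathbb{R}\to\mathbb{T}^2$ with $\int_t^{t'}L_a(\gamma,\dot\gamma)\,ds=-\Phi(\gamma(t'),\gamma(t))$ for all $t<t'$. A periodic orbit of the (autonomous) Euler-Lagrange flow is hyperbolic if, inside its energy level, the linearized Poincaré return map on a transversal section has no eigenvalue of modulus 1.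
   Formalization: That Γ_a is a hyperbolic periodic orbit is asserted only for c ≠ 0: for c = 0 the set Γ_a is a circle of equilibria of the Euler-Lagrange flow, hence not a periodic orbit. All other claims are proved for every real c. *)

theory Defs
  imports "HOL-Probability.Probability" "HOL-Library.Landau_Symbols"
begin

quotient_type circle = real / "\<lambda>x y. x - y \<in> \<int>"
  morphisms rep_circle circ
proof (rule equivpI)
  show "reflp (\<lambda>x y::real. x - y \<in> \<int>)"
    by (simp add: reflp_def)
  show "symp (\<lambda>x y::real. x - y \<in> \<int>)"
    by (metis (mono_tags, lifting) Ints_minus minus_diff_eq sympI)
  show "transp (\<lambda>x y::real. x - y \<in> \<int>)"
  proof (rule transpI)
    fix x y z :: real
    assume "x - y \<in> \<int>" "y - z \<in> \<int>"
    then have "(x - y) + (y - z) \<in> \<int>" by (rule Ints_add)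
    then show "x - z \<in> \<int>" by simp
  qed
qed

text \<open>The quotient topology.\<close>

instantiation circle :: topological_space
begin

definition open_circle :: "circle set \<Rightarrow> bool" where
  "open_circle U \<longleftrightarrow> open (circ -` U)"

instance
proof
  show "open (UNIV :: circle set)"
    by (simp add: open_circle_def)
  fix S T :: "circle set"
  assume "open S" "open T"
  then show "open (S \<inter> T)"
    by (simp add: open_circle_def vimage_Int open_Int)
next
  fix K :: "circle set set"
  assume "\<forall>S\<in>K. open S"
  then show "open (\<Union> K)"
    by (auto simp: open_circle_def vimage_Union)
qed

end

lift_definition cos_circle :: "circle \<Rightarrow> real" is "\<lambda>x. cos (2 * pi * x)"
proof -
  fix x y :: real
  assume "x - y \<in> \<int>"
  then obtain k :: int where "x - y = of_int k" by (auto elim: Ints_cases)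
  then have "x = y + of_int k" by simp
  then have "2 * pi * x = 2 * pi * y + 2 * pi * of_int k"
    by (simp only: distrib_left)
  then show "cos (2 * pi * x) = cos (2 * pi * y)"
    by (simp only: cos_add cos_int_2pin sin_int_2pin mult_1_right mult_zero_right diff_0_right)
qed

type_synonym torus = "circle \<times> circle"

text \<open>The tangent bundle of \<open>\<real>\<^sup>2/\<int>\<^sup>2\<close> is trivial; its points are pairs \<open>(q, v)\<close>.\<close>
type_synonym ttorus = "torus \<times> (real \<times> real)"

definition torus_proj :: "real \<times> real \<Rightarrow> torus" where
  "torus_proj = map_prod circ circ"

definition ttorus_proj :: "(real \<times> real) \<times> (real \<times> real) \<Rightarrow> ttorus" where
  "ttorus_proj = map_prod torus_proj id"

text \<open>Derivative of a curve at \<open>s\<close>, computed in a local lift to \<open>\<real>\<^sup>2\<close>.\<close>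
definition has_velocity :: "(real \<Rightarrow> torus) \<Rightarrow> real \<times> real \<Rightarrow> real \<Rightarrow> real set \<Rightarrow> bool" where
  "has_velocity \<gamma> v s S \<longleftrightarrow>
     (\<exists>g. \<gamma> s = torus_proj (g s) \<and> (\<forall>\<^sub>F r in at s within S. \<gamma> r = torus_proj (g r)) \<and>
          (g has_vector_derivative v) (at s within S))"

definition velocity :: "(real \<Rightarrow> torus) \<Rightarrow> real \<Rightarrow> real \<times> real" where
  "velocity \<gamma> s = (THE v. has_velocity \<gamma> v s UNIV)"

definition C1_curve_on :: "real set \<Rightarrow> (real \<Rightarrow> torus) \<Rightarrow> bool" where
  "C1_curve_on S \<gamma> \<longleftrightarrow> (\<exists>v. continuous_on S v \<and> (\<forall>s\<in>S. has_velocity \<gamma> (v s) s S))"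

text \<open>
  The library predicate \<open>piecewise_C1_differentiable_on\<close> is not suitable here, because it does not
  ask the derivative to have one-sided limits at the break points, so that the action could
  diverge (and the library integral would then be \<open>0\<close>).
\<close>
definition piecewise_C1_path :: "(real \<Rightarrow> torus) \<Rightarrow> real \<Rightarrow> real \<Rightarrow> bool" where
  "piecewise_C1_path \<gamma> a b \<longleftrightarrow>
     continuous_on {a..b} \<gamma> \<and>
     (\<exists>(n::nat) \<tau>. \<tau> 0 = a \<and> \<tau> n = b \<and>
        (\<forall>i<n. \<tau> i < \<tau> (Suc i) \<and> C1_curve_on {\<tau> i..\<tau> (Suc i)} \<gamma>))"

type_synonym lagrangian = "ttorus \<Rightarrow> real"

text \<open>The integrand may be undefined at the finitely many break points of \<open>\<gamma>\<close>.\<close>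
definition action :: "lagrangian \<Rightarrow> (real \<Rightarrow> torus) \<Rightarrow> real \<Rightarrow> real \<Rightarrow> real" where
  "action L \<gamma> a b = integral {a..b} (\<lambda>s. L (\<gamma> s, velocity \<gamma> s))"

text \<open>
  \<open>p = \<partial>L/\<partial>v\<close> and \<open>f = \<partial>L/\<partial>q\<close> along the orbit; the Euler-Lagrange equation is \<open>p' = f\<close>.
\<close>
definition euler_lagrange_orbit :: "lagrangian \<Rightarrow> (real \<Rightarrow> ttorus) \<Rightarrow> bool" where
  "euler_lagrange_orbit L \<eta> \<longleftrightarrow>
     (\<forall>s. has_velocity (fst \<circ> \<eta>) (snd (\<eta> s)) s UNIV) \<and>
     (\<exists>p f. \<forall>s.
        GDERIV (\<lambda>w. L (fst (\<eta> s), w)) (snd (\<eta> s)) :> p s \<and>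
        (\<exists>x. torus_proj x = fst (\<eta> s) \<and>
             GDERIV (\<lambda>x. L (torus_proj x, snd (\<eta> s))) x :> f s) \<and>
        (p has_vector_derivative f s) (at s))"

text \<open>Meaningful for Lagrangians whose Euler-Lagrange flow is complete.\<close>
definition EL_flow :: "lagrangian \<Rightarrow> real \<Rightarrow> ttorus \<Rightarrow> ttorus" where
  "EL_flow L t z = (THE \<eta>. euler_lagrange_orbit L \<eta> \<and> \<eta> 0 = z) t"

definition energy :: "lagrangian \<Rightarrow> ttorus \<Rightarrow> real" where
  "energy L = (\<lambda>(q, v). frechet_derivative (\<lambda>w. L (q, w)) (at v) v - L (q, v))"

definition EL_invariant_measure :: "lagrangian \<Rightarrow> ttorus measure \<Rightarrow> bool" where
  "EL_invariant_measure L \<mu> \<longleftrightarrow>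
     prob_space \<mu> \<and> sets \<mu> = sets borel \<and>
     (\<forall>t. EL_flow L t \<in> borel_measurable borel \<and> distr \<mu> borel (EL_flow L t) = \<mu>)"

text \<open>
  For Lagrangians bounded below, a measure with non-integrable \<open>L\<close> has action \<open>+\<infinity>\<close> and does not
  contribute to the minimum; the library integral would assign it the value \<open>0\<close>, so
  integrability is required. \<open>LEAST\<close> is a genuine minimum and not an infimum.
\<close>
definition mane_critical_value :: "lagrangian \<Rightarrow> real" where
  "mane_critical_value L =
     - (LEAST r. \<exists>\<mu>. EL_invariant_measure L \<mu> \<and> integrable \<mu> L \<and> r = (\<integral>z. L z \<partial>\<mu>))"

text \<open>This potential and the Aubry set are those of the level \<open>0\<close>, for Lagrangians of critical value \<open>0\<close>.\<close>
definition action_potential :: "lagrangian \<Rightarrow> torus \<Rightarrow> torus \<Rightarrow> real" where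
  "action_potential L q q' =
     Inf {action L \<gamma> 0 t | \<gamma> t. t > 0 \<and> piecewise_C1_path \<gamma> 0 t \<and> \<gamma> 0 = q \<and> \<gamma> t = q'}"

definition static_curve :: "lagrangian \<Rightarrow> (real \<Rightarrow> torus) \<Rightarrow> bool" where
  "static_curve L \<gamma> \<longleftrightarrow>
     C1_curve_on UNIV \<gamma> \<and>
     (\<forall>t t'. t < t' \<longrightarrow> action L \<gamma> t t' = - action_potential L (\<gamma> t') (\<gamma> t))"

definition aubry_set :: "lagrangian \<Rightarrow> ttorus set" where
  "aubry_set L = (\<Union>\<gamma>\<in>{\<gamma>. static_curve L \<gamma>}. range (\<lambda>s. (\<gamma> s, velocity \<gamma> s)))"

text \<open>
  \<open>X\<close> is the Euler-Lagrange vector field at \<open>z\<close>, in the coordinates of \<open>\<real>\<^sup>2 \<times> \<real>\<^sup>2\<close>.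
\<close>
definition EL_vector :: "lagrangian \<Rightarrow> ttorus \<Rightarrow> (real \<times> real) \<times> (real \<times> real) \<Rightarrow> bool" where
  "EL_vector L z X \<longleftrightarrow>
     has_velocity (\<lambda>t. fst (EL_flow L t z)) (fst X) 0 UNIV \<and>
     ((\<lambda>t. snd (EL_flow L t z)) has_vector_derivative snd X) (at 0)"

text \<open>
  A section through \<open>z\<close> inside the three-dimensional energy level of \<open>z\<close>, given by a
  parametrization \<open>\<sigma>\<close> over an open set \<open>U\<close> of \<open>\<real>\<^sup>2\<close> in the coordinates of \<open>\<real>\<^sup>2 \<times> \<real>\<^sup>2\<close>.
\<close>
definition transversal_section ::
  "lagrangian \<Rightarrow> ttorus \<Rightarrow> (real^2) set \<Rightarrow> (real^2 \<Rightarrow> (real \<times> real) \<times> (real \<times> real)) \<Rightarrow> bool" where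
  "transversal_section L z U \<sigma> \<longleftrightarrow>
     open U \<and> 0 \<in> U \<and> ttorus_proj (\<sigma> 0) = z \<and> inj_on (ttorus_proj \<circ> \<sigma>) U \<and>
     (\<forall>u\<in>U. energy L (ttorus_proj (\<sigma> u)) = energy L z) \<and>
     (\<exists>\<sigma>'. continuous_on U \<sigma>' \<and>
        (\<forall>u\<in>U. (\<sigma> has_derivative blinfun_apply (\<sigma>' u)) (at u) \<and>
               inj (blinfun_apply (\<sigma>' u)) \<and>
               (\<exists>X. EL_vector L (ttorus_proj (\<sigma> u)) X \<and> X \<notin> range (blinfun_apply (\<sigma>' u)))))"

text \<open>
  \<open>P\<close> is the first return map to the section near its centre, in the parameter \<open>u\<close>, and \<open>\<rho>\<close>
  the first return time; \<open>T\<close> is the period of the orbit through the centre.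
\<close>
definition poincare_map ::
  "lagrangian \<Rightarrow> real \<Rightarrow> (real^2) set \<Rightarrow> (real^2 \<Rightarrow> (real \<times> real) \<times> (real \<times> real)) \<Rightarrow>
   (real^2 \<Rightarrow> real^2) \<Rightarrow> bool" where
  "poincare_map L T U \<sigma> P \<longleftrightarrow>
     (\<exists>V \<rho>. open V \<and> 0 \<in> V \<and> V \<subseteq> U \<and> \<rho> 0 = T \<and> continuous_on V \<rho> \<and>
        (\<forall>u\<in>V. \<rho> u > 0 \<and> P u \<in> U \<and>
           EL_flow L (\<rho> u) (ttorus_proj (\<sigma> u)) = ttorus_proj (\<sigma> (P u)) \<and>
           (\<forall>s\<in>{0<..<\<rho> u}. EL_flow L s (ttorus_proj (\<sigma> u)) \<notin> (ttorus_proj \<circ> \<sigma>) ` U)))"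

definition complex_eigenvalue :: "(real^'n \<Rightarrow> real^'n) \<Rightarrow> complex \<Rightarrow> bool" where
  "complex_eigenvalue A k \<longleftrightarrow>
     (\<exists>w::complex^'n. w \<noteq> 0 \<and> (\<chi> i j. complex_of_real (matrix A $ i $ j)) *v w = k *s w)"

definition periodic_orbit :: "lagrangian \<Rightarrow> ttorus \<Rightarrow> real \<Rightarrow> ttorus set \<Rightarrow> bool" where
  "periodic_orbit L z T \<Gamma> \<longleftrightarrow>
     T > 0 \<and> EL_flow L T z = z \<and> (\<forall>s\<in>{0<..<T}. EL_flow L s z \<noteq> z) \<and>
     \<Gamma> = range (\<lambda>s. EL_flow L s z)"

definition hyperbolic_periodic_orbit :: "lagrangian \<Rightarrow> ttorus set \<Rightarrow> bool" where
  "hyperbolic_periodic_orbit L \<Gamma> \<longleftrightarrow>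
     (\<exists>z T U \<sigma> P A.
        periodic_orbit L z T \<Gamma> \<and> transversal_section L z U \<sigma> \<and> poincare_map L T U \<sigma> P \<and>
        (P has_derivative A) (at 0) \<and> (\<forall>k. complex_eigenvalue A k \<longrightarrow> cmod k \<noteq> 1))"

definition lax_oleinik :: "lagrangian \<Rightarrow> real \<Rightarrow> (torus \<Rightarrow> real) \<Rightarrow> torus \<Rightarrow> real" where
  "lax_oleinik L t u q =
     Inf {u (\<gamma> 0) + action L \<gamma> 0 t | \<gamma>. piecewise_C1_path \<gamma> 0 t \<and> \<gamma> t = q}"

definition L_a :: "real \<Rightarrow> lagrangian" where
  "L_a c = (\<lambda>((x, y), (vx, vy)). vx\<^sup>2 / 2 + 1 - cos_circle x + (vy - c)\<^sup>2 / 2)"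

text \<open>For \<open>c = 0\<close> this is a circle of equilibria and hence not a periodic orbit.\<close>
definition Gamma_a :: "real \<Rightarrow> ttorus set" where
  "Gamma_a c = ({circ 0} \<times> UNIV) \<times> ({0} \<times> {c})"

end

(*
  Writing x' for the velocity, 1 - cos (2 pi x) = 2 sin^2 (pi x) gives
  L_a >= +-2 sin (pi x) x' + m (y' - c) - m^2 / 2 for every real m, a total derivative. Hence
  T_t u (x, y) = S x + V_t y for u (x, y) = S x + 1 - cos (2 pi y), where
  S x = (2/pi) (1 - |cos (pi x)|) and V_t y = inf_z (1 - cos (2 pi z) + (y - z - c t)^2 / (2 t)).
  Always 0 <= V_t <= 1 / (2 t), and V_t y >= 1 / (32 t) whenever y - c t = 1/2 modulo 1.
  The remaining claims hold because L_a is nonnegative and vanishes exactly on Gamma_a, and because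
  the x-equation is a pendulum whose linearization at x = 0 has the exponents 2 pi and -2 pi.
*)
theory Submission
  imports Defs
begin

section \<open>Circle and torus\<close>

text \<open>Hyperbolicity controls the motion transversal to the circle x = 0, but along the circle
  the flow is a rotation without any contraction; this is why the rate is only polynomial. A
  minimizer that must arrive at a prescribed phase can start at a bad phase, where u is large, or
  deviate from the speed c. Spreading a phase shift d evenly over the time t costs d^2 / (2 t), so
  for large t the second option wins, and its cost is the error. The parameter m is the Legendre
  dual of this shift: it stays free until the estimates for all pieces of a path have been added.
  The flow is given by a definite description, so everything about it rests on global existence and
  uniqueness of solutions, and curves on the torus have to be lifted to the plane. Hyperbolicity
  concerns the derivative of the return map at one point only, and a quadratic estimate of the
  pendulum against its linearization yields it.\<close>

lemma circ_eq_iff: "circ x = circ y \<longleftrightarrow> x - y \<in> \<int>"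
  by (rule circle.abs_eq_iff)

lemma circ_surj: "\<exists>x. q = circ x"
  by (rule circle.abs_induct) blast

lemma torus_proj_Pair [simp]: "torus_proj (x, y) = (circ x, circ y)"
  by (simp add: torus_proj_def)

lemma ttorus_proj_Pair [simp]: "ttorus_proj (x, v) = (torus_proj x, v)"
  by (simp add: ttorus_proj_def)

lemma torus_proj_surj: "\<exists>x. q = torus_proj x"
  using circ_surj by (metis prod.exhaust torus_proj_Pair)

lemma ttorus_proj_surj: "\<exists>x. q = ttorus_proj x"
  using torus_proj_surj by (metis prod.exhaust ttorus_proj_Pair)

text \<open>This embedding into the complex plane lets a curve on the circle be differentiated as
  one global function, whereas \<open>has_velocity\<close> speaks of an unspecified local
  lift.\<close>

lift_definition cis_circle :: "circle \<Rightarrow> complex" is "\<lambda>x. cis (2 * pi * x)"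
proof -
  fix x y :: real
  assume "x - y \<in> \<int>"
  then have "cis (2 * pi * (x - y)) = 1"
    by (rule cis_multiple_2pi)
  then show "cis (2 * pi * x) = cis (2 * pi * y)"
    by (simp add: right_diff_distrib flip: cis_divide)
qed

lemma cis_circle_circ [simp]: "cis_circle (circ x) = cis (2 * pi * x)"
  by (rule cis_circle.abs_eq)

lemma cos_circle_circ [simp]: "cos_circle (circ x) = cos (2 * pi * x)"
  by (rule cos_circle.abs_eq)

lemma cis_circle_inj: "cis_circle p = cis_circle q \<Longrightarrow> p = q"
proof -
  assume *: "cis_circle p = cis_circle q"
  obtain x y where xy: "p = circ x" "q = circ y"
    using circ_surj by blast
  then have "sin (2 * pi * x) = sin (2 * pi * y)" "cos (2 * pi * x) = cos (2 * pi * y)"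
    using * by (auto simp: complex_eq_iff)
  then obtain n :: int where "2 * pi * x = 2 * pi * y + 2 * pi * n"
    using sin_cos_eq_iff by blast
  then have "2 * pi * x = 2 * pi * (y + n)"
    by (simp only: distrib_left)
  then have "x - y = n"
    by simp
  then show ?thesis
    by (simp add: xy circ_eq_iff)
qed

lemma circ_uminus_of_int [simp]: "circ (x - of_int n) = circ x"
  by (simp add: circ_eq_iff)

lemma circ_plus_of_int [simp]: "circ (x + of_int n) = circ x"
  by (simp add: circ_eq_iff)

lemma circ_in_unit_interval: "\<exists>x. \<bar>x\<bar> \<le> 1/2 \<and> q = circ x"
proof -
  obtain x where q: "q = circ x"
    using circ_surj by blast
  have "\<bar>x - round x\<bar> \<le> 1/2"
    using of_int_round_abs_le[of x] by linarith
  then show ?thesis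
    using q by (intro exI[of _ "x - round x"]) simp
qed

section \<open>Quotient topology of the torus and its tangent bundle\<close>

lemma continuous_on_circ: "continuous_on UNIV circ"
  by (simp add: continuous_on_open_vimage open_circle_def)

text \<open>The preimage of the image of U is the union of all integer translates of U, each of
  which is open.\<close>

lemma open_image_circ:
  assumes "open U"
  shows "open (circ ` U)"
proof -
  have "circ -` circ ` U = (\<Union>n::int. (\<lambda>x. x + of_int n) -` U)"
    (is "?L = ?R")
  proof (intro subset_antisym subsetI)
    fix x assume "x \<in> ?L"
    then obtain y where y: "y \<in> U" "circ x = circ y" by auto
    then have "y - x \<in> \<int>"
      by (metis circ_eq_iff)
    then obtain n where "y - x = of_int n"
      by (auto elim: Ints_cases)
    then have "x + of_int n \<in> U"
      using y by (simp add: algebra_simps)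
    then show "x \<in> ?R" by auto
  next
    fix x assume "x \<in> ?R"
    then obtain n :: int where "x + of_int n \<in> U" by auto
    then show "x \<in> ?L"
      by (metis circ_plus_of_int imageI vimageI)
  qed
  moreover have "open ((\<lambda>x::real. x + of_int n) -` U)" for n
    by (intro open_vimage assms continuous_intros)
  ultimately show ?thesis
    unfolding open_circle_def by (metis open_UN)
qed

lemma open_image_map_prod:
  assumes f: "\<And>U. open U \<Longrightarrow> open (f ` U)" and g: "\<And>U. open U \<Longrightarrow> open (g ` U)"
    and W: "open W"
  shows "open (map_prod f g ` W)"
  unfolding open_prod_def
proof
  fix z assume "z \<in> map_prod f g ` W"
  then obtain x y where xy: "(x, y) \<in> W" "z = (f x, g y)" by auto
  obtain A B where "open A" "open B" "(x, y) \<in> A \<times> B" "A \<times> B \<subseteq> W"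
    using open_prod_elim[OF W xy(1)] .
  then show "\<exists>A B. open A \<and> open B \<and> z \<in> A \<times> B \<and> A \<times> B \<subseteq> map_prod f g ` W"
    using f g xy by (intro exI[of _ "f ` A"] exI[of _ "g ` B"]) auto
qed

lemma open_image_ttorus_proj: "open W \<Longrightarrow> open (ttorus_proj ` W)"
  unfolding ttorus_proj_def torus_proj_def
  by (intro open_image_map_prod open_image_circ) auto

lemma continuous_on_torus_proj: "continuous_on UNIV torus_proj"
proof -
  have "continuous_on UNIV (\<lambda>x. (circ (fst x), circ (snd x)))"
    by (intro continuous_on_Pair continuous_on_compose2[OF continuous_on_circ]) 
      (auto intro: continuous_intros)
  then show ?thesis
    by (simp add: torus_proj_def map_prod_def case_prod_unfold)
qed

lemma continuous_on_ttorus_proj: "continuous_on UNIV ttorus_proj"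
proof -
  have "continuous_on UNIV (\<lambda>x. (torus_proj (fst x), snd x))"
    by (intro continuous_on_Pair continuous_on_compose2[OF continuous_on_torus_proj]) 
      (auto intro: continuous_intros)
  then show ?thesis
    by (simp add: ttorus_proj_def map_prod_def case_prod_unfold)
qed

text \<open>\<open>ttorus_proj\<close> is an open surjection, hence a quotient map: continuity can
  be tested in the coordinates of the plane.\<close>

lemma continuous_on_ttorusI:
  assumes "continuous_on UNIV (\<lambda>z. f (ttorus_proj z))"
  shows "continuous_on UNIV f"
proof -
  have "open (f -` W)" if "open W" for W
  proof -
    have "f -` W = ttorus_proj ` ((\<lambda>z. f (ttorus_proj z)) -` W)"
      using ttorus_proj_surj by (fastforce simp only: set_eq_iff image_iff vimage_eq)
    then show ?thesis
      using open_image_ttorus_proj that assms by (metis open_vimage)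
  qed
  then show ?thesis
    by (simp add: continuous_on_open_vimage)
qed

lemma continuous_on_cos_circle: "continuous_on UNIV cos_circle"
proof -
  have "open (cos_circle -` W)" if "open W" for W
  proof -
    have "circ -` cos_circle -` W = (\<lambda>x. cos (2 * pi * x)) -` W"
      by auto
    moreover have "open ((\<lambda>x. cos (2 * pi * x)) -` W)"
      by (intro open_vimage that continuous_intros)
    ultimately show ?thesis
      by (simp add: open_circle_def)
  qed
  then show ?thesis
    by (simp add: continuous_on_open_vimage)
qed

lemma continuous_on_L_a: "continuous_on UNIV (L_a c)"
proof -
  have "continuous_on UNIV
      (\<lambda>z::ttorus. (fst (snd z))\<^sup>2 / 2 + 1 - cos_circle (fst (fst z)) + (snd (snd z) - c)\<^sup>2 / 2)"
    by (intro continuous_intros continuous_on_compose2[OF continuous_on_cos_circle]) auto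
  then show ?thesis
    by (simp add: L_a_def case_prod_unfold)
qed

section \<open>Velocities and global lifts of curves\<close>

lemma has_vector_derivative_cis:
  fixes f :: "real \<Rightarrow> real"
  assumes "(f has_vector_derivative d) (at s within S)"
  shows "((\<lambda>r. cis (k * f r)) has_vector_derivative of_real (k * d) * (\<i> * cis (k * f s))) (at s within S)"
  using has_derivative_cis[OF has_derivative_mult_right[OF assms[unfolded has_vector_derivative_def], of k]]
  by (simp add: has_vector_derivative_def scaleR_conv_of_real mult_ac)

text \<open>The chain rule in the local lift. The lift is gone from the conclusion, and v can be
  recovered from it because the factor \<open>cis_circle\<close> never vanishes.\<close>

lemma has_velocity_cis:
  assumes "has_velocity \<gamma> v s S" and "s \<in> S"
  shows "((\<lambda>r. cis_circle (fst (\<gamma> r))) has_vector_derivative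
           2 * pi * fst v * (\<i> * cis_circle (fst (\<gamma> s)))) (at s within S)"
    and "((\<lambda>r. cis_circle (snd (\<gamma> r))) has_vector_derivative
           2 * pi * snd v * (\<i> * cis_circle (snd (\<gamma> s)))) (at s within S)"
proof -
  obtain g where g: "\<gamma> s = torus_proj (g s)" "\<forall>\<^sub>F r in at s within S. \<gamma> r = torus_proj (g r)"
     "(g has_vector_derivative v) (at s within S)"
    using assms unfolding has_velocity_def by blast
  note d = has_vector_derivative_cis[OF bounded_linear.has_vector_derivative[OF _ g(3)],
      where k = "2 * pi", unfolded has_vector_derivative_def]
  have eq: "cis_circle (fst (torus_proj z)) = cis (2 * pi * fst z)"
    "cis_circle (snd (torus_proj z)) = cis (2 * pi * snd z)" for z
    by (cases z; simp)+
  show "((\<lambda>r. cis_circle (fst (\<gamma> r))) has_vector_derivative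
           2 * pi * fst v * (\<i> * cis_circle (fst (\<gamma> s)))) (at s within S)"
    unfolding has_vector_derivative_def
    by (rule has_derivative_transform_eventually[OF d[OF bounded_linear_fst, folded eq, folded g(1)]])
      (use g(2) assms(2) in \<open>auto simp: eq g(1) elim: eventually_mono\<close>)
  show "((\<lambda>r. cis_circle (snd (\<gamma> r))) has_vector_derivative
           2 * pi * snd v * (\<i> * cis_circle (snd (\<gamma> s)))) (at s within S)"
    unfolding has_vector_derivative_def
    by (rule has_derivative_transform_eventually[OF d[OF bounded_linear_snd, folded eq, folded g(1)]])
      (use g(2) assms(2) in \<open>auto simp: eq g(1) elim: eventually_mono\<close>)
qed

lemma cis_circle_nonzero [simp]: "cis_circle q \<noteq> 0"
  by (metis circ_surj cis_circle_circ cis_neq_zero)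

lemma has_velocity_unique:
  assumes "has_velocity \<gamma> v s UNIV" and "has_velocity \<gamma> w s UNIV"
  shows "v = w"
proof (rule prod_eqI)
  show "fst v = fst w"
    using vector_derivative_unique_at[OF has_velocity_cis(1)[OF assms(1)] has_velocity_cis(1)[OF assms(2)]]
    by simp
  show "snd v = snd w"
    using vector_derivative_unique_at[OF has_velocity_cis(2)[OF assms(1)] has_velocity_cis(2)[OF assms(2)]]
    by simp
qed

lemma velocity_eqI: "has_velocity \<gamma> v s UNIV \<Longrightarrow> velocity \<gamma> s = v"
  unfolding velocity_def using has_velocity_unique by blast

lemma has_velocity_torus_proj:
  "(g has_vector_derivative v) (at s within S) \<Longrightarrow> has_velocity (\<lambda>s. torus_proj (g s)) v s S"
  unfolding has_velocity_def by (intro exI[of _ g]) auto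

text \<open>Connects the one-sided derivatives in \<open>C1_curve_on\<close> with the two-sided
  \<open>velocity\<close> in the action.\<close>

lemma has_velocity_interior:
  "has_velocity \<gamma> v s S \<Longrightarrow> s \<in> interior S \<Longrightarrow> has_velocity \<gamma> v s UNIV"
  using at_within_interior[of s S] by (simp add: has_velocity_def)

text \<open>
  No covering theory is needed: the quotient of the two curves in the unit circle has derivative 0.
\<close>

lemma cis_curve_eq:
  fixes f :: "real \<Rightarrow> real" and h :: "real \<Rightarrow> complex"
  assumes "convex S" and "s\<^sub>0 \<in> S" and "h s\<^sub>0 = cis (2 * pi * f s\<^sub>0)"
    and h: "\<And>s. s \<in> S \<Longrightarrow> (h has_vector_derivative 2 * pi * d s * (\<i> * h s)) (at s within S)"
    and f: "\<And>s. s \<in> S \<Longrightarrow> (f has_vector_derivative d s) (at s within S)"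
    and "s \<in> S"
  shows "h s = cis (2 * pi * f s)"
proof -
  define k where "k = (\<lambda>s. h s * cis (- (2 * pi * f s)))"
  have k: "(k has_derivative (\<lambda>_. 0)) (at s within S)" if s: "s \<in> S" for s
  proof -
    have "((\<lambda>r. cis (- (2 * pi * f r))) has_vector_derivative
           - (2 * pi * d s) * (\<i> * cis (- (2 * pi * f s)))) (at s within S)"
      using has_vector_derivative_cis[OF f[OF s], of "- (2 * pi)"]
      by (simp only: minus_mult_left mult.assoc)
    from has_vector_derivative_mult[OF h[OF s] this]
    have "(k has_vector_derivative 0) (at s within S)"
      unfolding k_def by (rule has_vector_derivative_eq_rhs) (simp add: mult_ac)
    then show ?thesis
      by (simp add: has_vector_derivative_def)
  qed
  have "\<exists>C. \<forall>s\<in>S. k s = C"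
    by (rule has_derivative_zero_constant[OF \<open>convex S\<close> k])
  then obtain C where C: "\<And>s. s \<in> S \<Longrightarrow> k s = C"
    by blast
  have "k s\<^sub>0 = 1"
    by (simp add: k_def assms(3) cis_mult)
  then have "k s = 1"
    using C[OF \<open>s\<^sub>0 \<in> S\<close>] C[OF \<open>s \<in> S\<close>] by metis
  moreover have "h s = k s * cis (2 * pi * f s)"
    unfolding k_def mult.assoc cis_mult by simp
  ultimately show ?thesis
    by simp
qed

text \<open>Integrating the velocities produces a global lift: in each coordinate both curves,
  embedded in the unit circle, solve the same linear equation with the same value at one
  time.\<close>

lemma lift_eq:
  assumes "convex S" and "s\<^sub>0 \<in> S" and "\<gamma> s\<^sub>0 = torus_proj (g s\<^sub>0)"
    and v: "\<And>s. s \<in> S \<Longrightarrow> has_velocity \<gamma> (v s) s S"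
    and g: "\<And>s. s \<in> S \<Longrightarrow> (g has_vector_derivative v s) (at s within S)"
    and "s \<in> S"
  shows "\<gamma> s = torus_proj (g s)"
proof -
  have eq: "\<gamma> s\<^sub>0 = (circ (fst (g s\<^sub>0)), circ (snd (g s\<^sub>0)))"
    using assms(3) by (cases "g s\<^sub>0") simp
  have "cis_circle (fst (\<gamma> s)) = cis (2 * pi * fst (g s))"
    by (rule cis_curve_eq[OF assms(1,2) _ has_velocity_cis(1)[OF v]
          bounded_linear.has_vector_derivative[OF bounded_linear_fst g] \<open>s \<in> S\<close>]) (auto simp: eq)
  moreover have "cis_circle (snd (\<gamma> s)) = cis (2 * pi * snd (g s))"
    by (rule cis_curve_eq[OF assms(1,2) _ has_velocity_cis(2)[OF v]
          bounded_linear.has_vector_derivative[OF bounded_linear_snd g] \<open>s \<in> S\<close>]) (auto simp: eq)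
  ultimately have "\<gamma> s = (circ (fst (g s)), circ (snd (g s)))"
    by (metis cis_circle_circ cis_circle_inj prod.collapse)
  then show ?thesis
    by (cases "g s") simp
qed

section \<open>Ordinary differential equations\<close>

text \<open>The squared norm is used because it is differentiable also where w vanishes. Its
  derivative is at most 2 K |w|^2 + 2 R |w|, and 2 R |w| is at most |w|^2 + R^2; this is the origin
  of the rate 2 K + 1.\<close>

lemma gronwall:
  fixes w :: "real \<Rightarrow> 'a::real_inner"
  assumes "0 \<le> t" "0 \<le> K"
    and w: "\<And>s. s \<in> {0..t} \<Longrightarrow> (w has_vector_derivative w' s) (at s)"
    and w': "\<And>s. s \<in> {0..t} \<Longrightarrow> norm (w' s) \<le> K * norm (w s) + R"
  shows "(norm (w t))\<^sup>2 + R\<^sup>2 \<le> exp ((2 * K + 1) * t) * ((norm (w 0))\<^sup>2 + R\<^sup>2)"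
proof -
  define f where "f = (\<lambda>s. exp (- (2 * K + 1) * s) * (w s \<bullet> w s + R\<^sup>2))"
  have "f t \<le> f 0"
  proof (rule DERIV_nonpos_imp_nonincreasing[OF \<open>0 \<le> t\<close>])
    fix s assume s: "0 \<le> s" "s \<le> t"
    have "((\<lambda>s. w s \<bullet> w s) has_real_derivative 2 * (w s \<bullet> w' s)) (at s)"
      using has_derivative_inner[OF w[unfolded has_vector_derivative_def] w[unfolded has_vector_derivative_def], of s] s
      by (simp add: has_field_derivative_def inner_commute fun_eq_iff mult.commute)
         (auto elim!: has_derivative_eq_rhs simp: algebra_simps inner_commute fun_eq_iff)
    then have "(f has_real_derivative exp (- (2 * K + 1) * s) *
        (2 * (w s \<bullet> w' s) - (2 * K + 1) * (w s \<bullet> w s + R\<^sup>2))) (at s)"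
      unfolding f_def by (auto intro!: derivative_eq_intros simp: algebra_simps)
    moreover have "2 * (w s \<bullet> w' s) - (2 * K + 1) * (w s \<bullet> w s + R\<^sup>2) \<le> 0"
    proof -
      have "w s \<bullet> w' s \<le> norm (w s) * (K * norm (w s) + R)"
        using norm_cauchy_schwarz[of "w s" "w' s"] w'[of s] s
        by (meson atLeastAtMost_iff mult_left_mono norm_ge_zero order_trans)
      moreover have "0 \<le> (norm (w s) - R)\<^sup>2" "0 \<le> K * R\<^sup>2"
        using \<open>0 \<le> K\<close> by auto
      moreover have "w s \<bullet> w s = (norm (w s))\<^sup>2"
        by (rule dot_square_norm)
      ultimately show ?thesis
        by (simp add: power2_eq_square algebra_simps)
    qed
    ultimately show "\<exists>y. (f has_real_derivative y) (at s) \<and> y \<le> 0"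
      by (intro exI conjI) (auto simp: mult_le_0_iff)
  qed
  then have "exp ((2 * K + 1) * t) * f t \<le> exp ((2 * K + 1) * t) * f 0"
    by (intro mult_left_mono) auto
  moreover have "exp ((2 * K + 1) * t) * exp (- (2 * K + 1) * t) = 1"
    by (simp add: algebra_simps flip: exp_add)
  then have "exp ((2 * K + 1) * t) * f t = (norm (w t))\<^sup>2 + R\<^sup>2"
    by (simp only: f_def dot_square_norm mult_1 flip: mult.assoc)
  moreover have "f 0 = (norm (w 0))\<^sup>2 + R\<^sup>2"
    by (simp add: f_def dot_square_norm)
  ultimately show ?thesis
    by simp
qed

lemma has_vector_derivative_reflect:
  "(x has_vector_derivative d) (at (- s)) \<Longrightarrow> ((\<lambda>s. x (- s)) has_vector_derivative - d) (at s)"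
  for s :: real
  using vector_diff_chain_at[OF has_vector_derivative_minus[OF has_vector_derivative_id], of x d s]
  by (simp add: o_def)

text \<open>Gronwall with R = 0, applied to the time-reversed curves for negative t. It yields both
  uniqueness and Lipschitz dependence on the initial value.\<close>

lemma solution_dist:
  fixes F :: "'a::real_inner \<Rightarrow> 'a"
  assumes "0 \<le> K" and lip: "\<And>x y. norm (F x - F y) \<le> K * norm (x - y)"
    and x: "\<And>s. (x has_vector_derivative F (x s)) (at s)"
    and y: "\<And>s. (y has_vector_derivative F (y s)) (at s)"
  shows "(norm (x t - y t))\<^sup>2 \<le> exp ((2 * K + 1) * \<bar>t\<bar>) * (norm (x 0 - y 0))\<^sup>2"
proof (cases "0 \<le> t")
  case True
  have "(norm (x t - y t))\<^sup>2 + 0\<^sup>2 \<le> exp ((2 * K + 1) * t) * ((norm (x 0 - y 0))\<^sup>2 + 0\<^sup>2)"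
    using lip
    by (intro gronwall[where w' = "\<lambda>s. F (x s) - F (y s)"] True assms(1) has_vector_derivative_diff x y) simp
  then show ?thesis
    using True by simp
next
  case False
  let ?w = "\<lambda>s. x (- s) - y (- s)"
  have "(norm (?w (- t)))\<^sup>2 + 0\<^sup>2 \<le> exp ((2 * K + 1) * - t) * ((norm (?w 0))\<^sup>2 + 0\<^sup>2)"
  proof (rule gronwall)
    show "norm (- F (x (- s)) - - F (y (- s))) \<le> K * norm (?w s) + 0" for s
      using lip[of "x (- s)" "y (- s)"] by (simp add: norm_minus_commute)
    show "(?w has_vector_derivative - F (x (- s)) - - F (y (- s))) (at s)" for s
      by (intro has_vector_derivative_diff has_vector_derivative_reflect x y)
  qed (use False assms in auto)
  then show ?thesis
    using False by simp
qed

section \<open>Global solutions for Lipschitz vector fields\<close>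

lemma antiderivative_continuous_real:
  fixes h :: "real \<Rightarrow> 'a::euclidean_space"
  assumes "continuous_on UNIV h"
  shows "\<exists>H. H 0 = 0 \<and> (\<forall>t. (H has_vector_derivative h t) (at t))"
proof -
  \<comment> \<open>The interval integral is oriented, so one formula is an antiderivative on both
    sides of 0.\<close>
  define H where "H = (\<lambda>t. LBINT y=ereal 0..ereal t. h y)"
  have "H 0 = 0"
    by (simp add: H_def)
  moreover have "(H has_vector_derivative h t) (at t)" for t
  proof -
  define a b where "a = - (\<bar>t\<bar> + 1)" and "b = \<bar>t\<bar> + 1"
  have "(H has_vector_derivative h t) (at t within {a..b})"
    unfolding H_def using continuous_on_subset[OF assms]
    by (intro interval_integral_FTC2) (auto simp: a_def b_def)
  moreover have "t \<in> interior {a..b}"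
    by (auto simp: a_def b_def)
  ultimately show ?thesis
    using at_within_interior[of t "{a..b}"] by simp
  qed
  ultimately show ?thesis
    by blast
qed

text \<open>The gain 1 / k from integrating the exponential is the point: with k twice the Lipschitz
  constant K it turns K into the contraction ratio 1/2.\<close>

lemma norm_exp_growth:
  fixes H :: "real \<Rightarrow> 'a::real_normed_vector"
  assumes "k > 0" "H 0 = 0" and H: "\<And>t. (H has_vector_derivative h t) (at t)"
    and h: "\<And>t. norm (h t) \<le> M * exp (k * \<bar>t\<bar>)"
  shows "norm (H t) \<le> M / k * exp (k * \<bar>t\<bar>)"
proof -
  have *: "norm (H t) \<le> M / k * exp (k * t)" if "0 < t" "H 0 = 0" 
    and H: "\<And>t. (H has_vector_derivative h t) (at t)"
    and h: "\<And>t. norm (h t) \<le> M * exp (k * \<bar>t\<bar>)" for t and H h :: "real \<Rightarrow> 'a"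
  proof -
    have "norm (H t - H 0) \<le> M / k * exp (k * t) - M / k * exp (k * 0)"
    proof (rule differentiable_bound_general[OF \<open>0 < t\<close>])
      show "continuous_on {0..t} H"
        using H by (meson continuous_at_imp_continuous_on has_vector_derivative_continuous)
      show "continuous_on {0..t} (\<lambda>t. M / k * exp (k * t))"
        by (intro continuous_intros)
      show "((\<lambda>t. M / k * exp (k * t)) has_vector_derivative M * exp (k * x)) (at x)" for x
        using \<open>k > 0\<close> unfolding has_real_derivative_iff_has_vector_derivative[symmetric]
        by (auto intro!: derivative_eq_intros)
      show "norm (h x) \<le> M * exp (k * x)" if "0 < x" for x
        using h[of x] that by simp
    qed (use H in auto)
    moreover have "0 \<le> M"
      using order_trans[OF norm_ge_zero h[of 0]] by simp
    ultimately show ?thesis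
      using \<open>k > 0\<close> \<open>H 0 = 0\<close> by (simp add: field_simps)
  qed
  have "0 \<le> M"
    using order_trans[OF norm_ge_zero h[of 0]] by simp
  consider "t > 0" | "t = 0" | "t < 0" by linarith
  then show ?thesis
  proof cases
    case 1
    then show ?thesis
      using *[OF _ assms(2) H h] by simp
  next
    case 2
    then show ?thesis
      using \<open>0 \<le> M\<close> assms by simp
  next
    case 3
    have "norm (H (- (- t))) \<le> M / k * exp (k * (- t))"
      using 3 h[of "- _"] assms(2) 
      by (intro *[of "- t" "\<lambda>s. H (- s)" "\<lambda>s. - h (- s)"] has_vector_derivative_reflect H) auto
    then show ?thesis
      using 3 by simp
  qed
qed

text \<open>
  Writing a solution as \<open>z + exp (2K|t|) w(t)\<close> with \<open>w\<close> bounded turns the Picard operator into a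
  contraction of ratio \<open>1/2\<close> on the bounded continuous functions on the whole line.
\<close>

lemma lipschitz_global_solution:
  fixes F :: "'a::euclidean_space \<Rightarrow> 'a"
  assumes "K > 0" and lip: "\<And>x y. norm (F x - F y) \<le> K * norm (x - y)"
  shows "\<exists>x. x 0 = z \<and> (\<forall>t. (x has_vector_derivative F (x t)) (at t))"
proof -
  define W where "W = (\<lambda>t. exp (2 * K * \<bar>t\<bar>))"
  have W: "W t > 0" "W t \<ge> 1" for t
    using \<open>K > 0\<close> by (auto simp: W_def)
  have contW: "continuous_on UNIV W"
    unfolding W_def by (intro continuous_intros)
  have contF: "continuous_on UNIV F"
    using lip \<open>K > 0\<close> by (intro lipschitz_on_continuous_on[of K] lipschitz_onI) (auto simp: dist_norm)
  define h where "h = (\<lambda>w::real \<Rightarrow>\<^sub>C 'a. \<lambda>t. F (z + W t *\<^sub>R apply_bcontfun w t))"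
  have conth: "continuous_on UNIV (h w)" for w
    unfolding h_def
    by (intro continuous_on_compose2[OF contF] continuous_intros contW) auto
  define H where "H = (\<lambda>w. SOME H. H 0 = 0 \<and> (\<forall>t. (H has_vector_derivative h w t) (at t)))"
  have H: "H w 0 = 0" "(H w has_vector_derivative h w t) (at t)" for w t
    using someI_ex[OF antiderivative_continuous_real[OF conth[of w]]] by (auto simp: H_def)
  have contH: "continuous_on UNIV (H w)" for w
    using H(2) by (meson continuous_at_imp_continuous_on has_vector_derivative_continuous)
  have bound: "norm (H w t) / W t \<le> (norm (F z) + K * norm w) / (2 * K)" for w t
  proof -
    have "norm (h w s) \<le> (norm (F z) + K * norm w) * exp (2 * K * \<bar>s\<bar>)" for s
    proof -
      have "norm (h w s) \<le> norm (F z) + norm (h w s - F z)"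
        by (rule norm_triangle_sub)
      also have "norm (h w s - F z) \<le> K * (W s * norm (apply_bcontfun w s))"
        using lip[of "z + W s *\<^sub>R apply_bcontfun w s" z] W[of s] by (simp add: h_def)
      also have "\<dots> \<le> K * (W s * norm w)"
        using norm_bounded[of w s] W[of s] \<open>K > 0\<close> by (intro mult_left_mono) auto
      also have "norm (F z) \<le> norm (F z) * W s"
        using W[of s] by (simp add: mult_le_cancel_left1)
      finally show ?thesis
        by (simp add: W_def algebra_simps)
    qed
    from norm_exp_growth[OF _ H this, of t] show ?thesis
      using \<open>K > 0\<close> W[of t] by (simp add: W_def pos_divide_le_eq)
  qed
  \<comment> \<open>\<open>Bcontfun\<close> is meaningful only for bounded continuous functions;
    \<open>bound\<close> supplies the boundedness.\<close>
  define T where "T = (\<lambda>w. Bcontfun (\<lambda>t. H w t /\<^sub>R W t))"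
  have T: "apply_bcontfun (T w) t = H w t /\<^sub>R W t" for w t
  proof -
    have "(\<lambda>t. H w t /\<^sub>R W t) \<in> bcontfun"
    proof (rule bcontfun_normI)
      show "continuous_on UNIV (\<lambda>t. H w t /\<^sub>R W t)"
        using W by (intro continuous_intros contH contW) (auto simp: less_imp_neq[symmetric])
      show "norm (H w t /\<^sub>R W t) \<le> (norm (F z) + K * norm w) / (2 * K)" for t
        using bound[of w t] W[of t] by (simp add: field_simps)
    qed
    then show ?thesis
      by (simp add: T_def Bcontfun_inverse)
  qed
  have "dist (T w) (T w') \<le> 1/2 * dist w w'" for w w'
  proof (rule dist_bound)
    fix t
    have "norm (h w s - h w' s) \<le> (K * dist w w') * exp (2 * K * \<bar>s\<bar>)" for s
    proof -
      have "norm (h w s - h w' s) \<le> K * norm (W s *\<^sub>R (apply_bcontfun w s - apply_bcontfun w' s))"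
        using lip[of "z + W s *\<^sub>R apply_bcontfun w s" "z + W s *\<^sub>R apply_bcontfun w' s"]
        by (simp add: h_def scaleR_diff_right)
      also have "\<dots> \<le> K * (W s * dist w w')"
        using dist_bounded[of w s w'] W[of s] \<open>K > 0\<close>
        by (auto intro!: mult_left_mono simp: dist_norm)
      finally show ?thesis
        by (simp add: W_def mult_ac)
    qed
    moreover have "H w 0 - H w' 0 = 0"
      by (simp add: H)
    ultimately have "norm (H w t - H w' t) \<le> (K * dist w w') / (2 * K) * exp (2 * K * \<bar>t\<bar>)"
      using \<open>K > 0\<close>
      by (intro norm_exp_growth[where H = "\<lambda>t. H w t - H w' t" and h = "\<lambda>t. h w t - h w' t"]
          has_vector_derivative_diff H(2)) auto
    also have "\<dots> = (1/2 * dist w w') * W t"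
      using \<open>K > 0\<close> by (simp add: W_def)
    finally have "norm (H w t - H w' t) / W t \<le> 1/2 * dist w w'"
      using W[of t] by (simp only: pos_divide_le_eq)
    moreover have "dist (apply_bcontfun (T w) t) (apply_bcontfun (T w') t) = norm (H w t - H w' t) / W t"
      using W(1)[of t] by (simp add: T dist_norm divide_inverse mult.commute flip: scaleR_diff_right)
    ultimately show "dist (apply_bcontfun (T w) t) (apply_bcontfun (T w') t) \<le> 1/2 * dist w w'"
      by simp
  qed
  then obtain w where w: "T w = w"
    using banach_fix_type[of "1/2" T] by auto
  \<comment> \<open>At the fixed point the rescaled function is the antiderivative itself, so the
    integrand \<open>h w t\<close> becomes \<open>F (z + H w t)\<close>.\<close>
  have eq: "H w t = W t *\<^sub>R apply_bcontfun w t" for t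
    using T[of w t] W[of t] by (simp add: w)
  show ?thesis
  proof (intro exI conjI allI)
    show "z + H w 0 = z"
      by (simp add: H)
    show "((\<lambda>t. z + H w t) has_vector_derivative F (z + H w t)) (at t)" for t
      using has_vector_derivative_add[OF has_vector_derivative_const H(2), of z w t]
      by (simp add: h_def eq)
  qed
qed

section \<open>The Euler-Lagrange flow\<close>

lemma abs_sin_diff_le: "\<bar>sin a - sin b\<bar> \<le> \<bar>a - b\<bar>" for a b :: real
proof -
  have "\<bar>sin a - sin b\<bar> = 2 * (\<bar>sin ((a - b) / 2)\<bar> * \<bar>cos ((a + b) / 2)\<bar>)"
    by (simp add: sin_diff_sin abs_mult)
  also have "\<dots> \<le> 2 * (\<bar>(a - b) / 2\<bar> * 1)"
    by (intro mult_left_mono mult_mono abs_sin_x_le_abs_x abs_cos_le_one) auto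
  finally show ?thesis
    by simp
qed

text \<open>The x-part of the Euler-Lagrange equation, x'' = 2 pi sin (2 pi x), as a first-order
  system. The sign makes the origin a saddle.\<close>

definition pend_field :: "real \<times> real \<Rightarrow> real \<times> real" where
  "pend_field z = (snd z, 2 * pi * sin (2 * pi * fst z))"

text \<open>The summand 1 comes from x' = v, and 4 pi^2 is the largest slope of 2 pi sin (2 pi
  x).\<close>

definition pend_lip :: real where
  "pend_lip = 1 + 4 * pi\<^sup>2"

lemma pend_lip_pos: "pend_lip > 0"
  by (simp add: pend_lip_def add_pos_nonneg)

lemma pend_field_lipschitz: "norm (pend_field z - pend_field w) \<le> pend_lip * norm (z - w)"
proof -
  have "norm (pend_field z - pend_field w)
      \<le> \<bar>snd z - snd w\<bar> + \<bar>2 * pi * sin (2 * pi * fst z) - 2 * pi * sin (2 * pi * fst w)\<bar>"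
    unfolding pend_field_def diff_Pair by (metis norm_Pair_le real_norm_def)
  also have "\<bar>2 * pi * sin (2 * pi * fst z) - 2 * pi * sin (2 * pi * fst w)\<bar>
      = 2 * pi * \<bar>sin (2 * pi * fst z) - sin (2 * pi * fst w)\<bar>"
    by (simp add: abs_mult flip: right_diff_distrib)
  also have "\<dots> \<le> 2 * pi * \<bar>2 * pi * fst z - 2 * pi * fst w\<bar>"
    by (intro mult_left_mono abs_sin_diff_le) auto
  also have "\<dots> = 4 * pi\<^sup>2 * \<bar>fst (z - w)\<bar>"
    by (simp add: abs_mult power2_eq_square flip: right_diff_distrib)
  also have "\<dots> \<le> 4 * pi\<^sup>2 * norm (z - w)"
    using norm_fst_le[of "fst (z - w)" "snd (z - w)", unfolded prod.collapse real_norm_def] by (intro mult_left_mono) auto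
  also have "\<bar>snd z - snd w\<bar> \<le> norm (z - w)"
    using norm_snd_le[of "snd (z - w)" "fst (z - w)", unfolded prod.collapse real_norm_def] by simp
  finally show ?thesis
    by (simp add: pend_lip_def algebra_simps)
qed

section \<open>The pendulum flow\<close>

definition pend :: "real \<times> real \<Rightarrow> real \<Rightarrow> real \<times> real" where
  "pend z = (SOME x. x 0 = z \<and> (\<forall>t. (x has_vector_derivative pend_field (x t)) (at t)))"

lemma pend_0 [simp]: "pend z 0 = z"
  and pend_deriv: "(pend z has_vector_derivative pend_field (pend z t)) (at t)"
  using someI_ex[OF lipschitz_global_solution[OF pend_lip_pos pend_field_lipschitz, of z]]
  by (auto simp: pend_def)

lemma pend_dist:
  "(norm (pend z t - pend w t))\<^sup>2 \<le> exp ((2 * pend_lip + 1) * \<bar>t\<bar>) * (norm (z - w))\<^sup>2"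
  using solution_dist[where x = "pend z" and y = "pend w",
      OF less_imp_le[OF pend_lip_pos] pend_field_lipschitz pend_deriv pend_deriv]
  by simp

lemma pend_unique:
  assumes "\<And>t. (x has_vector_derivative pend_field (x t)) (at t)"
  shows "x t = pend (x 0) t"
  using solution_dist[where x = x and y = "pend (x 0)",
      OF less_imp_le[OF pend_lip_pos] pend_field_lipschitz assms pend_deriv, of t]
  by simp

lemma continuous_on_pend: "continuous_on UNIV (\<lambda>z. pend z t)"
proof -
  define M where "M = sqrt (exp ((2 * pend_lip + 1) * \<bar>t\<bar>))"
  have "norm (pend z t - pend w t) \<le> M * norm (z - w)" for z w
    using real_sqrt_le_mono[OF pend_dist[of z t w]] by (simp add: M_def real_sqrt_mult)
  then have "M-lipschitz_on UNIV (\<lambda>z. pend z t)"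
    by (intro lipschitz_onI) (auto simp: dist_norm M_def)
  then show ?thesis
    by (rule lipschitz_on_continuous_on)
qed

text \<open>The Lagrangian is a sum of an x-part and a y-part, so the flow is a pendulum times
  uniform motion. It does not depend on c, because c enters the Lagrangian only through a constant
  and a total derivative.\<close>

definition lift_flow :: "real \<Rightarrow> (real \<times> real) \<times> (real \<times> real) \<Rightarrow> (real \<times> real) \<times> (real \<times> real)" where
  "lift_flow t = (\<lambda>((x, y), (vx, vy)).
     ((fst (pend (x, vx) t), y + vy * t), (snd (pend (x, vx) t), vy)))"

lemma lift_flow_0 [simp]: "lift_flow 0 Z = Z"
  by (simp add: lift_flow_def split: prod.splits)

lemma lift_flow_fst_deriv:
  "((\<lambda>t. fst (lift_flow t Z)) has_vector_derivative snd (lift_flow t Z)) (at t)"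
proof -
  obtain x y vx vy where Z: "Z = ((x, y), (vx, vy))"
    by (metis prod.exhaust)
  have "((\<lambda>t. fst (pend (x, vx) t)) has_vector_derivative snd (pend (x, vx) t)) (at t)"
    using bounded_linear.has_vector_derivative[OF bounded_linear_fst pend_deriv[of "(x, vx)" t]]
    by (simp add: pend_field_def)
  moreover have "((\<lambda>t. y + vy * t) has_vector_derivative vy) (at t)"
    by (auto intro!: derivative_eq_intros simp flip: has_real_derivative_iff_has_vector_derivative)
  ultimately show ?thesis
    by (simp add: Z lift_flow_def has_vector_derivative_Pair)
qed

lemma lift_flow_snd_deriv:
  "((\<lambda>t. snd (lift_flow t Z)) has_vector_derivative
     (2 * pi * sin (2 * pi * fst (fst (lift_flow t Z))), 0)) (at t)"
proof -
  obtain x y vx vy where Z: "Z = ((x, y), (vx, vy))"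
    by (metis prod.exhaust)
  have "((\<lambda>t. snd (pend (x, vx) t)) has_vector_derivative
      2 * pi * sin (2 * pi * fst (pend (x, vx) t))) (at t)"
    using bounded_linear.has_vector_derivative[OF bounded_linear_snd pend_deriv[of "(x, vx)" t]]
    by (simp add: pend_field_def)
  then show ?thesis
    by (simp add: Z lift_flow_def has_vector_derivative_Pair)
qed

section \<open>Identification of the Euler-Lagrange flow\<close>

lemma L_a_torus_proj:
  "L_a c (torus_proj x, w) = (fst w)\<^sup>2 / 2 + 1 - cos (2 * pi * fst x) + (snd w - c)\<^sup>2 / 2"
  by (cases x; cases w) (simp add: L_a_def)

text \<open>\<open>euler_lagrange_orbit\<close> only asserts that some momentum and some force
  exist; this identifies them with the explicit gradients.\<close>

lemma GDERIV_unique: "GDERIV f x :> d \<Longrightarrow> GDERIV f x :> d' \<Longrightarrow> d = d'"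
proof -
  assume "GDERIV f x :> d" "GDERIV f x :> d'"
  then have "(\<lambda>h. h \<bullet> d) = (\<lambda>h. h \<bullet> d')"
    unfolding gderiv_def by (rule has_derivative_unique)
  then have "(d - d') \<bullet> (d - d') = 0"
    by (simp add: inner_diff_right fun_eq_iff)
  then show ?thesis
    by simp
qed

lemma GDERIV_L_a_velocity: "GDERIV (\<lambda>w. L_a c (q, w)) v :> (fst v, snd v - c)"
proof -
  obtain x where q: "q = torus_proj x"
    using torus_proj_surj by blast
  show ?thesis
    unfolding gderiv_def q L_a_torus_proj
    by (auto intro!: derivative_eq_intros simp: inner_prod_def field_simps fun_eq_iff)
qed

lemma GDERIV_L_a_position:
  "GDERIV (\<lambda>x. L_a c (torus_proj x, w)) x :> (2 * pi * sin (2 * pi * fst x), 0)"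
  unfolding gderiv_def L_a_torus_proj
  by (auto intro!: derivative_eq_intros simp: inner_prod_def algebra_simps)

lemma euler_lagrange_orbit_lift_flow:
  "euler_lagrange_orbit (L_a c) (\<lambda>t. ttorus_proj (lift_flow t Z))"
  unfolding euler_lagrange_orbit_def
proof (intro conjI allI exI)
  fix s
  have eq: "ttorus_proj z = (torus_proj (fst z), snd z)" for z
    by (cases z) simp
  show "has_velocity (fst \<circ> (\<lambda>t. ttorus_proj (lift_flow t Z))) (snd (ttorus_proj (lift_flow s Z))) s UNIV"
    unfolding o_def eq fst_conv snd_conv by (intro has_velocity_torus_proj lift_flow_fst_deriv)
  show "GDERIV (\<lambda>w. L_a c (fst (ttorus_proj (lift_flow s Z)), w)) (snd (ttorus_proj (lift_flow s Z)))
      :> (\<lambda>s. snd (lift_flow s Z) - (0, c)) s"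
    using GDERIV_L_a_velocity[of c _ "snd (lift_flow s Z)"] unfolding eq fst_conv snd_conv
    by (cases "snd (lift_flow s Z)") simp
  show "torus_proj (fst (lift_flow s Z)) = fst (ttorus_proj (lift_flow s Z))"
    by (simp add: eq)
  show "GDERIV (\<lambda>x. L_a c (torus_proj x, snd (ttorus_proj (lift_flow s Z)))) (fst (lift_flow s Z))
      :> (\<lambda>s. (2 * pi * sin (2 * pi * fst (fst (lift_flow s Z))), 0)) s"
    by (rule GDERIV_L_a_position)
  show "((\<lambda>s. snd (lift_flow s Z) - (0, c)) has_vector_derivative
      (\<lambda>s. (2 * pi * sin (2 * pi * fst (fst (lift_flow s Z))), 0)) s) (at s)"
    using has_vector_derivative_diff[OF lift_flow_snd_deriv[of Z s] has_vector_derivative_const] by simp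
qed

text \<open>The momentum is the velocity shifted by the constant (0, c), so the velocity is
  differentiable. Its antiderivative is a global lift, on which the equations split into the
  pendulum and uniform motion in y.\<close>

lemma euler_lagrange_orbit_unique:
  assumes "euler_lagrange_orbit (L_a c) \<eta>" and \<eta>0: "\<eta> 0 = ttorus_proj Z"
  shows "\<eta> t = ttorus_proj (lift_flow t Z)"
proof -
  obtain x y vx vy where Z: "Z = ((x, y), (vx, vy))"
    by (metis prod.exhaust)
  define w where "w = (\<lambda>s. snd (\<eta> s))"
  obtain p f where
      v: "\<And>s. has_velocity (fst \<circ> \<eta>) (w s) s UNIV"
    and p: "\<And>s. GDERIV (\<lambda>w. L_a c (fst (\<eta> s), w)) (w s) :> p s"
    and f: "\<And>s. \<exists>x. torus_proj x = fst (\<eta> s) \<and> GDERIV (\<lambda>x. L_a c (torus_proj x, w s)) x :> f s"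
    and pf: "\<And>s. (p has_vector_derivative f s) (at s)"
    using assms(1) unfolding euler_lagrange_orbit_def w_def by blast
  have w_eq: "w = (\<lambda>s. p s + (0, c))"
    using GDERIV_unique[OF p GDERIV_L_a_velocity] by (simp add: fun_eq_iff)
  have w: "(w has_vector_derivative f s) (at s)" for s
    unfolding w_eq using has_vector_derivative_add[OF pf has_vector_derivative_const] by simp
  then have "continuous_on UNIV w"
    by (meson continuous_at_imp_continuous_on has_vector_derivative_continuous)
  from antiderivative_continuous_real[OF this] obtain G where
    G: "G 0 = 0" "\<And>t. (G has_vector_derivative w t) (at t)"
    by blast
  define g where "g = (\<lambda>t. (x, y) + G t)"
  have g: "(g has_vector_derivative w t) (at t)" for t
    unfolding g_def using has_vector_derivative_add[OF has_vector_derivative_const G(2)] by simp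
  have proj_g: "fst (\<eta> t) = torus_proj (g t)" for t
    using lift_eq[of UNIV 0 "fst \<circ> \<eta>" g w] v g by (simp add: g_def G \<eta>0 Z)
  \<comment> \<open>The gradient is taken at some lift of the point, chosen anew for every s. It
    differs from \<open>g s\<close> by integers, which the sine does not see.\<close>
  have f_eq: "f s = (2 * pi * sin (2 * pi * fst (g s)), 0)" for s
  proof -
    obtain x where x: "torus_proj x = fst (\<eta> s)" "GDERIV (\<lambda>x. L_a c (torus_proj x, w s)) x :> f s"
      using f by blast
    then have "circ (fst x) = circ (fst (g s))"
      unfolding proj_g by (metis fst_conv prod.collapse torus_proj_Pair)
    then have "cis (2 * pi * fst x) = cis (2 * pi * fst (g s))"
      by (metis cis_circle_circ)
    then have "sin (2 * pi * fst x) = sin (2 * pi * fst (g s))"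
      by (simp add: complex_eq_iff)
    then show ?thesis
      using GDERIV_unique[OF x(2) GDERIV_L_a_position] by simp
  qed
  have "((\<lambda>s. (fst (g s), fst (w s))) has_vector_derivative pend_field (fst (g t), fst (w t))) (at t)" for t
    using has_vector_derivative_Pair[OF bounded_linear.has_vector_derivative[OF bounded_linear_fst g]
        bounded_linear.has_vector_derivative[OF bounded_linear_fst w], of t]
    by (simp add: pend_field_def f_eq)
  from pend_unique[OF this, of t] have 1: "(fst (g t), fst (w t)) = pend (x, vx) t"
    by (simp add: g_def G w_def \<eta>0 Z)
  have "((\<lambda>s. snd (w s)) has_vector_derivative 0) (at t)" for t
    using bounded_linear.has_vector_derivative[OF bounded_linear_snd w, of t] by (simp add: f_eq)
  then obtain C where "\<And>s. snd (w s) = C"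
    using has_derivative_zero_constant[of UNIV "\<lambda>s. snd (w s)"]
    by (auto simp: has_vector_derivative_def)
  then have 2: "snd (w s) = vy" for s
    by (metis Z \<eta>0 snd_conv ttorus_proj_Pair w_def)
  have "((\<lambda>s. snd (g s) - vy * s) has_vector_derivative 0) (at t)" for t
    using bounded_linear.has_vector_derivative[OF bounded_linear_snd g, of t]
    by (auto intro!: derivative_eq_intros simp: 2 simp flip: has_real_derivative_iff_has_vector_derivative)
  then obtain C where "\<And>s. snd (g s) - vy * s = C"
    using has_derivative_zero_constant[of UNIV "\<lambda>s. snd (g s) - vy * s"]
    by (auto simp: has_vector_derivative_def)
  from this[of t] this[of 0] have 3: "snd (g t) = y + vy * t"
    by (simp add: g_def G)
  have "g t = (fst (pend (x, vx) t), y + vy * t)" "w t = (snd (pend (x, vx) t), vy)"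
    using 1 2[of t] 3 by (metis fst_conv snd_conv prod.collapse)+
  then have "(torus_proj (g t), w t) = ttorus_proj (lift_flow t Z)"
    by (simp add: Z lift_flow_def)
  then show ?thesis
    by (simp add: w_def flip: proj_g)
qed

lemma EL_flow_L_a: "EL_flow (L_a c) t (ttorus_proj Z) = ttorus_proj (lift_flow t Z)"
proof -
  have "(THE \<eta>. euler_lagrange_orbit (L_a c) \<eta> \<and> \<eta> 0 = ttorus_proj Z) = (\<lambda>t. ttorus_proj (lift_flow t Z))"
    by (intro the_equality conjI ext euler_lagrange_orbit_lift_flow)
      (simp, blast intro: euler_lagrange_orbit_unique)
  then show ?thesis
    by (simp add: EL_flow_def)
qed

lemma continuous_on_EL_flow: "continuous_on UNIV (EL_flow (L_a c) t)"
proof (rule continuous_on_ttorusI)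
  have "continuous_on UNIV (\<lambda>Z. ((fst (pend (fst (fst Z), fst (snd Z)) t), snd (fst Z) + snd (snd Z) * t),
      (snd (pend (fst (fst Z), fst (snd Z)) t), snd (snd Z))))"
    by (intro continuous_intros continuous_on_compose2[OF continuous_on_pend]) auto
  then have "continuous_on UNIV (lift_flow t)"
    by (simp add: lift_flow_def case_prod_unfold)
  then show "continuous_on UNIV (\<lambda>Z. EL_flow (L_a c) t (ttorus_proj Z))"
    unfolding EL_flow_L_a by (intro continuous_on_compose2[OF continuous_on_ttorus_proj]) auto
qed

section \<open>The Aubry set and the action of piecewise C1 paths\<close>

lemma L_a_nonneg: "0 \<le> L_a c z"
proof -
  obtain x w where "z = (torus_proj x, w)"
    using torus_proj_surj by (metis prod.exhaust)
  then have z: "L_a c z = (fst w)\<^sup>2 / 2 + 1 - cos (2 * pi * fst x) + (snd w - c)\<^sup>2 / 2"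
    by (simp only: L_a_torus_proj)
  show ?thesis
    using cos_le_one[of "2 * pi * fst x"] zero_le_power2[of "fst w"] zero_le_power2[of "snd w - c"]
    unfolding z by linarith
qed

text \<open>If the integrand is not integrable, the integral is 0 by convention, which agrees with
  the bound.\<close>

lemma action_nonneg: "0 \<le> action (L_a c) \<gamma> a b"
  unfolding action_def
  by (cases "(\<lambda>s. L_a c (\<gamma> s, velocity \<gamma> s)) integrable_on {a..b}")
    (auto intro!: integral_nonneg L_a_nonneg simp: not_integrable_integral)

lemma velocity_torus_proj:
  assumes "\<And>s. (g has_vector_derivative v s) (at s)"
  shows "velocity (\<lambda>s. torus_proj (g s)) s = v s"
  by (intro velocity_eqI has_velocity_torus_proj assms)

lemma C1_curve_on_torus_proj:
  assumes "\<And>s. (g has_vector_derivative v s) (at s)" and "continuous_on UNIV v"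
  shows "C1_curve_on S (\<lambda>s. torus_proj (g s))"
  unfolding C1_curve_on_def
  using assms
  by (intro exI[of _ v] conjI ballI has_velocity_torus_proj)
    (auto intro: continuous_on_subset has_vector_derivative_at_within)

lemma piecewise_C1_path_torus_proj:
  assumes g: "\<And>s. (g has_vector_derivative v s) (at s)" and "continuous_on UNIV v" and "a < b"
  shows "piecewise_C1_path (\<lambda>s. torus_proj (g s)) a b"
  unfolding piecewise_C1_path_def
proof (intro conjI exI)
  have "continuous_on {a..b} g"
    using g by (meson continuous_at_imp_continuous_on has_vector_derivative_continuous)
  then show "continuous_on {a..b} (\<lambda>s. torus_proj (g s))"
    by (intro continuous_on_compose2[OF continuous_on_torus_proj]) auto
  let ?\<tau> = "\<lambda>i::nat. if i = 0 then a else b"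
  show "?\<tau> 0 = a" "?\<tau> 1 = b" by auto
  show "\<forall>i<1. ?\<tau> i < ?\<tau> (Suc i) \<and> C1_curve_on {?\<tau> i..?\<tau> (Suc i)} (\<lambda>s. torus_proj (g s))"
    using C1_curve_on_torus_proj[OF assms(1,2)] \<open>a < b\<close> by simp
qed

lemma action_torus_proj:
  assumes "\<And>s. (g has_vector_derivative v s) (at s)"
  shows "action L (\<lambda>s. torus_proj (g s)) a b = integral {a..b} (\<lambda>s. L (torus_proj (g s), v s))"
  unfolding action_def velocity_torus_proj[OF assms] ..

lemma has_vector_derivative_line:
  "((\<lambda>s. p + s *\<^sub>R v) has_vector_derivative v) (at s within S)"
  by (auto intro!: derivative_eq_intros)

text \<open>A lower bound passes to the real infimum only over a nonempty set; a segment between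
  lifts is a competitor.\<close>

lemma action_potential_nonneg: "0 \<le> action_potential (L_a c) q q'"
proof -
  obtain p p' where p: "q = torus_proj p" "q' = torus_proj p'"
    using torus_proj_surj by blast
  let ?\<gamma> = "\<lambda>s. torus_proj (p + s *\<^sub>R (p' - p))"
  have path: "piecewise_C1_path ?\<gamma> 0 1"
    by (intro piecewise_C1_path_torus_proj[OF has_vector_derivative_line]) auto
  have "action (L_a c) ?\<gamma> 0 1 \<in> {action (L_a c) \<gamma> 0 t | \<gamma> t. t > 0 \<and> piecewise_C1_path \<gamma> 0 t \<and> \<gamma> 0 = q \<and> \<gamma> t = q'}"
    unfolding p by (intro CollectI exI[of _ ?\<gamma>] exI[of _ 1] conjI path) auto
  then show ?thesis
    unfolding action_potential_def by (intro cInf_greatest) (blast, auto intro: action_nonneg)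
qed

lemma action_potential_le:
  assumes "t > 0" "piecewise_C1_path \<gamma> 0 t"
  shows "action_potential (L_a c) (\<gamma> 0) (\<gamma> t) \<le> action (L_a c) \<gamma> 0 t"
  unfolding action_potential_def using assms
  by (intro cInf_lower bdd_belowI[of _ 0]) (auto intro: action_nonneg)

text \<open>Both sides vanish: the line runs in the zero set of the Lagrangian, and a way back
  becomes arbitrarily cheap as its duration grows.\<close>

lemma static_line: "static_curve (L_a c) (\<lambda>s. torus_proj ((0, y) + s *\<^sub>R (0, c)))"
  unfolding static_curve_def
proof (intro conjI allI impI)
  show "C1_curve_on UNIV (\<lambda>s. torus_proj ((0, y) + s *\<^sub>R (0, c)))"
    by (intro C1_curve_on_torus_proj[OF has_vector_derivative_line]) auto
  fix t t' :: real
  assume "t < t'"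
  text \<open>
    Moving along the circle \<open>x = 0\<close> with speed \<open>c + e / T\<close>, where \<open>c T + e\<close> and \<open>(t - t') c\<close> agree
    modulo 1, closes the curve at cost at most \<open>1 / (2 T)\<close>.
  \<close>
  have le: "action_potential (L_a c) (torus_proj ((0, y) + t' *\<^sub>R (0, c))) (torus_proj ((0, y) + t *\<^sub>R (0, c)))
      \<le> 1 / (2 * T)" if "T > 0" for T
  proof -
    define e where "e = (t - t') * c - c * T - of_int \<lfloor>(t - t') * c - c * T\<rfloor>"
    let ?g = "\<lambda>s. (0::real, y + t' * c) + s *\<^sub>R (0, c + e / T)"
    have e: "0 \<le> e" "e \<le> 1"
      unfolding e_def by linarith+
    have "action (L_a c) (\<lambda>s. torus_proj (?g s)) 0 T = integral {0..T} (\<lambda>s. (e / T)\<^sup>2 / 2)"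
      unfolding action_torus_proj[OF has_vector_derivative_line] by (simp add: L_a_torus_proj del: torus_proj_Pair)
    also have "\<dots> = e\<^sup>2 / (2 * T)"
      using that by (simp add: power2_eq_square field_simps)
    also have "\<dots> \<le> 1 / (2 * T)"
      using e that by (intro divide_right_mono) (auto simp: power_le_one)
    finally have "action (L_a c) (\<lambda>s. torus_proj (?g s)) 0 T \<le> 1 / (2 * T)" .
    moreover have "action_potential (L_a c) (torus_proj (?g 0)) (torus_proj (?g T))
        \<le> action (L_a c) (\<lambda>s. torus_proj (?g s)) 0 T"
      by (rule action_potential_le[OF that piecewise_C1_path_torus_proj[OF has_vector_derivative_line _ that]]) simp
    moreover have "T * (c + e / T) = T * c + e"
      using that by (simp add: distrib_left)
    then have "?g T = (0, y + t * c - of_int \<lfloor>(t - t') * c - c * T\<rfloor>)"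
      by (simp add: e_def algebra_simps)
    then have "torus_proj (?g T) = torus_proj ((0, y) + t *\<^sub>R (0, c))"
      by (simp only: torus_proj_Pair circ_uminus_of_int) simp
    ultimately show ?thesis
      by simp
  qed
  have "action_potential (L_a c) (torus_proj ((0, y) + t' *\<^sub>R (0, c))) (torus_proj ((0, y) + t *\<^sub>R (0, c))) \<le> 0"
  proof (rule field_le_epsilon)
    fix e :: real
    assume "e > 0"
    then show "action_potential (L_a c) (torus_proj ((0, y) + t' *\<^sub>R (0, c))) (torus_proj ((0, y) + t *\<^sub>R (0, c))) \<le> 0 + e"
      using le[of "1 / (2 * e)"] by simp
  qed
  moreover have "action (L_a c) (\<lambda>s. torus_proj ((0, y) + s *\<^sub>R (0, c))) t t' = 0"
    unfolding action_torus_proj[OF has_vector_derivative_line] by (simp add: L_a_torus_proj del: torus_proj_Pair)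
  ultimately show "action (L_a c) (\<lambda>s. torus_proj ((0, y) + s *\<^sub>R (0, c))) t t' =
      - action_potential (L_a c) (torus_proj ((0, y) + t' *\<^sub>R (0, c))) (torus_proj ((0, y) + t *\<^sub>R (0, c)))"
    using action_potential_nonneg by (metis antisym minus_zero)
qed

lemma L_a_eq_0_iff: "L_a c z = 0 \<longleftrightarrow> z \<in> Gamma_a c"
proof -
  obtain x y v w where z: "z = (torus_proj (x, y), (v, w))"
    using torus_proj_surj by (metis prod.exhaust)
  have "L_a c z = 0 \<longleftrightarrow> v = 0 \<and> cos (2 * pi * x) = 1 \<and> w = c"
  proof -
    have "0 \<le> v\<^sup>2" "0 \<le> 1 - cos (2 * pi * x)" "0 \<le> (w - c)\<^sup>2"
      by auto
    then have "v\<^sup>2 / 2 + 1 - cos (2 * pi * x) + (w - c)\<^sup>2 / 2 = 0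
        \<longleftrightarrow> v\<^sup>2 = 0 \<and> 1 - cos (2 * pi * x) = 0 \<and> (w - c)\<^sup>2 = 0"
      by linarith
    then show ?thesis
      by (simp add: z L_a_torus_proj del: torus_proj_Pair) 
  qed
  also have "cos (2 * pi * x) = 1 \<longleftrightarrow> circ x = circ 0"
    by (auto simp: cos_one_2pi_int circ_eq_iff Ints_def)
  finally show ?thesis
    by (auto simp: z Gamma_a_def)
qed

text \<open>On a static curve the nonnegative action equals minus a nonnegative potential, so it is
  0. The integrand is continuous and nonnegative, hence vanishes along the whole curve.\<close>

lemma aubry_set_L_a: "aubry_set (L_a c) = Gamma_a c"
proof (intro subset_antisym subsetI)
  fix z assume "z \<in> Gamma_a c"
  then obtain q where "z = ((circ 0, q), (0, c))"
    by (auto simp: Gamma_a_def)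
  then obtain y where z: "z = (torus_proj (0, y), (0, c))"
    using circ_surj by (metis torus_proj_Pair)
  let ?\<gamma> = "\<lambda>s. torus_proj ((0, y) + s *\<^sub>R (0, c))"
  have "z = (?\<gamma> 0, velocity ?\<gamma> 0)"
    by (simp add: z velocity_torus_proj[OF has_vector_derivative_line] del: torus_proj_Pair scaleR_Pair)
  then show "z \<in> aubry_set (L_a c)"
    unfolding aubry_set_def using static_line[of c y] by blast
next
  fix z assume "z \<in> aubry_set (L_a c)"
  then obtain \<gamma> s where \<gamma>: "static_curve (L_a c) \<gamma>" and z: "z = (\<gamma> s, velocity \<gamma> s)"
    by (auto simp: aubry_set_def)
  obtain v where v: "continuous_on UNIV v" "\<And>s. has_velocity \<gamma> (v s) s UNIV"
    using \<gamma> by (auto simp: static_curve_def C1_curve_on_def)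
  obtain G where G: "G 0 = 0" "\<And>t. (G has_vector_derivative v t) (at t)"
    using antiderivative_continuous_real[OF v(1)] by blast
  obtain p where p: "\<gamma> 0 = torus_proj p"
    using torus_proj_surj by blast
  have G': "((\<lambda>t. p + G t) has_vector_derivative v t) (at t)" for t
    using has_vector_derivative_add[OF has_vector_derivative_const G(2)] by simp
  have eq: "\<gamma> t = torus_proj (p + G t)" for t
    using lift_eq[of UNIV 0 \<gamma> "\<lambda>t. p + G t" v] v(2) G' by (simp add: G p)
  have "continuous_on UNIV (\<lambda>t. p + G t)"
    using G' by (meson continuous_at_imp_continuous_on has_vector_derivative_continuous)
  \<comment> \<open>Continuity of the curve itself comes from its lift, since
    \<open>C1_curve_on\<close> states only that of the velocity.\<close>
  then have "continuous_on UNIV (\<lambda>t. (\<gamma> t, v t))"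
    unfolding eq by (intro continuous_on_Pair v continuous_on_compose2[OF continuous_on_torus_proj]) auto
  then have cont: "continuous_on UNIV (\<lambda>t. L_a c (\<gamma> t, v t))"
    by (intro continuous_on_compose2[OF continuous_on_L_a]) auto
  have vel: "velocity \<gamma> t = v t" for t
    by (intro velocity_eqI v)
  have "action (L_a c) \<gamma> s (s + 1) = 0"
    using \<gamma> action_potential_nonneg[of c "\<gamma> (s + 1)" "\<gamma> s"] action_nonneg[of c \<gamma> s "s + 1"]
    by (auto simp: static_curve_def)
  then have "integral {s..s + 1} (\<lambda>t. L_a c (\<gamma> t, v t)) = 0"
    by (simp add: action_def vel)
  then have "L_a c (\<gamma> s, v s) = 0"
    using integral_eq_0_iff[of s "s + 1" "\<lambda>t. L_a c (\<gamma> t, v t)"] continuous_on_subset[OF cont] L_a_nonneg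
    by auto
  then show "z \<in> Gamma_a c"
    by (simp add: L_a_eq_0_iff z vel)
qed

section \<open>The calibrated lower bound for the action\<close>

text \<open>
  \<open>calib\<close> solves \<open>S'\<^sup>2 / 2 = 1 - cos (2 \<pi> x)\<close>: it is a fixed point of the Lax-Oleinik semigroup
  of the pendulum part of the Lagrangian.
\<close>

definition calib :: "real \<Rightarrow> real" where
  "calib x = 2 / pi * (1 - \<bar>cos (pi * x)\<bar>)"

text \<open>By the half-angle formula the square root is |cos (pi x)|. Going through
  \<open>cos_circle\<close> makes it well defined on the circle and continuous.\<close>

definition calib_circle :: "circle \<Rightarrow> real" where
  "calib_circle q = 2 / pi * (1 - sqrt ((1 + cos_circle q) / 2))"

lemma calib_circle_circ [simp]: "calib_circle (circ x) = calib x"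
proof -
  have "(1 + cos (2 * pi * x)) / 2 = (cos (pi * x))\<^sup>2"
    using cos_double_cos[of "pi * x"] by (simp add: mult.assoc)
  then show ?thesis
    by (simp add: calib_circle_def calib_def)
qed

text \<open>The pointwise bound is integrated with either sign of the pendulum term. Together the
  two results bound the absolute difference of the cosines, and so the increment of
  \<open>calib\<close>. One q serves all m, so that successive pieces can be added with a common m.
  Integrability is recorded because splitting the integral over pieces requires it.\<close>

lemma C1_curve_action_bound:
  assumes "a < b" "C1_curve_on {a..b} \<gamma>" "\<gamma> a = torus_proj p"
  shows "\<exists>q. \<gamma> b = torus_proj q \<and> (\<lambda>s. L_a c (\<gamma> s, velocity \<gamma> s)) integrable_on {a..b} \<and>
    (\<forall>m. calib (fst q) - calib (fst p) + m * (snd q - snd p - c * (b - a)) - m\<^sup>2 / 2 * (b - a)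
      \<le> action (L_a c) \<gamma> a b)"
proof -
  obtain v where v: "continuous_on {a..b} v" "\<And>s. s \<in> {a..b} \<Longrightarrow> has_velocity \<gamma> (v s) s {a..b}"
    using assms by (auto simp: C1_curve_on_def)
  define g where "g = (\<lambda>s. p + integral {a..s} v)"
  have g: "(g has_vector_derivative v s) (at s within {a..b})" if "s \<in> {a..b}" for s
    unfolding g_def
    using has_vector_derivative_add[OF has_vector_derivative_const integral_has_vector_derivative[OF v(1) that]]
    by simp
  have "g a = p"
    by (simp add: g_def)
  have eq: "\<gamma> s = torus_proj (g s)" if "s \<in> {a..b}" for s
    by (rule lift_eq[where \<gamma> = \<gamma>, OF convex_real_interval(5) _ _ v(2) g that, of a])
      (use assms \<open>g a = p\<close> in auto)
  have contg: "continuous_on {a..b} g"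
    using g by (meson continuous_on_eq_continuous_within has_vector_derivative_continuous)
  define l where "l = (\<lambda>s. L_a c (torus_proj (g s), v s))"
  have contl: "continuous_on {a..b} l"
    unfolding l_def
    by (intro continuous_on_compose2[OF continuous_on_L_a] continuous_on_Pair v(1)
        continuous_on_compose2[OF continuous_on_torus_proj] contg) auto
  \<comment> \<open>At the end points only one-sided derivatives are known, so the value of
    \<open>velocity\<close> there is uncertain; two points do not affect the integral.\<close>
  have spike: "L_a c (\<gamma> s, velocity \<gamma> s) = l s" if "s \<in> {a..b} - {a, b}" for s
  proof -
    have "velocity \<gamma> s = v s"
      using that by (intro velocity_eqI has_velocity_interior[of _ _ _ "{a..b}"] v(2)) auto
    then show ?thesis
      using that eq by (simp add: l_def)
  qed
  have l: "l integrable_on {a..b}"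
    by (rule integrable_continuous_real[OF contl])
  have int: "(\<lambda>s. L_a c (\<gamma> s, velocity \<gamma> s)) integrable_on {a..b}"
    by (rule integrable_spike_finite[OF _ _ l, of "{a, b}"]) (use spike in auto)
  have act: "action (L_a c) \<gamma> a b = integral {a..b} l"
    unfolding action_def by (rule integral_spike[of "{a, b}"]) (use spike in auto)
  have bound: "e * (2 / pi) * (cos (pi * fst p) - cos (pi * fst (g b)))
      + m * (snd (g b) - snd p - c * (b - a)) - m\<^sup>2 / 2 * (b - a) \<le> integral {a..b} l"
    if e: "e\<^sup>2 = 1" for e m
  proof -
    define f where "f = (\<lambda>s. - e * (2 / pi) * cos (pi * fst (g s)) + m * (snd (g s) - c * s) - m\<^sup>2 / 2 * s)"
    define f' where "f' = (\<lambda>s. e * (2 * sin (pi * fst (g s))) * fst (v s) + m * (snd (v s) - c) - m\<^sup>2 / 2)"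
    have "(f has_vector_derivative f' s) (at s within {a..b})" if "s \<in> {a..b}" for s
    proof -
      have "((\<lambda>s. fst (g s)) has_real_derivative fst (v s)) (at s within {a..b})"
        "((\<lambda>s. snd (g s)) has_real_derivative snd (v s)) (at s within {a..b})"
        using bounded_linear.has_vector_derivative[OF bounded_linear_fst g[OF that]]
          bounded_linear.has_vector_derivative[OF bounded_linear_snd g[OF that]]
        by (simp_all add: has_real_derivative_iff_has_vector_derivative)
      then show ?thesis
        unfolding has_real_derivative_iff_has_vector_derivative[symmetric] f_def f'_def
        by (auto intro!: derivative_eq_intros simp: field_simps)
    qed
    then have "(f' has_integral (f b - f a)) {a..b}"
      using \<open>a < b\<close> by (intro fundamental_theorem_of_calculus) auto
    moreover have "f' s \<le> l s" for s
    proof -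
      have "l s = (fst (v s))\<^sup>2 / 2 + 2 * (sin (pi * fst (g s)))\<^sup>2 + (snd (v s) - c)\<^sup>2 / 2"
        using cos_double_sin[of "pi * fst (g s)"] by (simp add: l_def L_a_torus_proj mult.assoc)
      moreover note sum_squares_bound[of "e * (2 * sin (pi * fst (g s)))" "fst (v s)"]
        sum_squares_bound[of m "snd (v s) - c"]
      moreover have "(e * (2 * sin (pi * fst (g s))))\<^sup>2 = 4 * (sin (pi * fst (g s)))\<^sup>2"
        by (simp add: power_mult_distrib e)
      ultimately show ?thesis
        unfolding f'_def by linarith
    qed
    ultimately have "f b - f a \<le> integral {a..b} l"
      using has_integral_le[OF _ integrable_integral[OF l]] by blast
    moreover have "f b - f a = e * (2 / pi) * (cos (pi * fst p) - cos (pi * fst (g b)))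
      + m * (snd (g b) - snd p - c * (b - a)) - m\<^sup>2 / 2 * (b - a)"
      by (simp add: f_def \<open>g a = p\<close> field_simps)
    ultimately show ?thesis
      by simp
  qed
  have "calib (fst (g b)) - calib (fst p) \<le> \<bar>2 / pi * (cos (pi * fst p) - cos (pi * fst (g b)))\<bar>"
  proof -
    have "calib (fst (g b)) - calib (fst p) = 2 / pi * (\<bar>cos (pi * fst p)\<bar> - \<bar>cos (pi * fst (g b))\<bar>)"
      by (simp add: calib_def algebra_simps)
    also have "\<dots> \<le> 2 / pi * \<bar>cos (pi * fst p) - cos (pi * fst (g b))\<bar>"
      by (intro mult_left_mono) auto
    also have "\<dots> = \<bar>2 / pi * (cos (pi * fst p) - cos (pi * fst (g b)))\<bar>"
      by (simp only: abs_mult) simp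
    finally show ?thesis .
  qed
  then have "calib (fst (g b)) - calib (fst p) + m * (snd (g b) - snd p - c * (b - a)) - m\<^sup>2 / 2 * (b - a)
      \<le> integral {a..b} l" for m
    using bound[of 1 m] bound[of "-1" m] by (simp add: abs_if split: if_splits)
  then show ?thesis
    using eq[of b] \<open>a < b\<close> int act by (intro exI[of _ "g b"]) auto
qed

text \<open>Each piece is lifted from the point where the previous lift ended, so the increments of
  \<open>calib\<close> and of y telescope.\<close>

lemma piecewise_C1_action_bound:
  assumes "\<forall>i<n. \<tau> i < \<tau> (Suc i) \<and> C1_curve_on {\<tau> i..\<tau> (Suc i)} \<gamma>" "\<gamma> (\<tau> 0) = torus_proj p"
  shows "\<exists>q. \<tau> 0 \<le> \<tau> n \<and> \<gamma> (\<tau> n) = torus_proj q \<and>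
    (\<lambda>s. L_a c (\<gamma> s, velocity \<gamma> s)) integrable_on {\<tau> 0..\<tau> n} \<and>
    (\<forall>m. calib (fst q) - calib (fst p) + m * (snd q - snd p - c * (\<tau> n - \<tau> 0)) - m\<^sup>2 / 2 * (\<tau> n - \<tau> 0)
      \<le> action (L_a c) \<gamma> (\<tau> 0) (\<tau> n))"
  using assms(1)
proof (induction n)
  case 0
  then show ?case
    using assms(2) by (intro exI[of _ p]) (auto simp: action_def integrable_on_refl[of _ "\<tau> 0", simplified])
next
  case (Suc n)
  then obtain q where q: "\<tau> 0 \<le> \<tau> n" "\<gamma> (\<tau> n) = torus_proj q"
    "(\<lambda>s. L_a c (\<gamma> s, velocity \<gamma> s)) integrable_on {\<tau> 0..\<tau> n}"
    "\<And>m. calib (fst q) - calib (fst p) + m * (snd q - snd p - c * (\<tau> n - \<tau> 0)) - m\<^sup>2 / 2 * (\<tau> n - \<tau> 0)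
      \<le> action (L_a c) \<gamma> (\<tau> 0) (\<tau> n)"
    by auto
  have n: "\<tau> n < \<tau> (Suc n)" "C1_curve_on {\<tau> n..\<tau> (Suc n)} \<gamma>"
    using Suc.prems by auto
  obtain r where r: "\<gamma> (\<tau> (Suc n)) = torus_proj r"
    "(\<lambda>s. L_a c (\<gamma> s, velocity \<gamma> s)) integrable_on {\<tau> n..\<tau> (Suc n)}"
    "\<forall>m. calib (fst r) - calib (fst q) + m * (snd r - snd q - c * (\<tau> (Suc n) - \<tau> n)) - m\<^sup>2 / 2 * (\<tau> (Suc n) - \<tau> n)
      \<le> action (L_a c) \<gamma> (\<tau> n) (\<tau> (Suc n))"
    using C1_curve_action_bound[OF n q(2), of c] by blast
  have int: "(\<lambda>s. L_a c (\<gamma> s, velocity \<gamma> s)) integrable_on {\<tau> 0..\<tau> (Suc n)}"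
    using Henstock_Kurzweil_Integration.integrable_combine[OF q(1) less_imp_le[OF n(1)] q(3) r(2)] .
  have act: "action (L_a c) \<gamma> (\<tau> 0) (\<tau> (Suc n)) = action (L_a c) \<gamma> (\<tau> 0) (\<tau> n) + action (L_a c) \<gamma> (\<tau> n) (\<tau> (Suc n))"
    unfolding action_def using Henstock_Kurzweil_Integration.integral_combine[OF q(1) less_imp_le[OF n(1)] int] by simp
  have "m\<^sup>2 / 2 * (\<tau> (Suc n) - \<tau> 0) = m\<^sup>2 / 2 * (\<tau> (Suc n) - \<tau> n) + m\<^sup>2 / 2 * (\<tau> n - \<tau> 0)"
    "m * (snd r - snd p - c * (\<tau> (Suc n) - \<tau> 0)) =
      m * (snd r - snd q - c * (\<tau> (Suc n) - \<tau> n)) + m * (snd q - snd p - c * (\<tau> n - \<tau> 0))" for m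
    by (simp_all add: field_simps)
  note split = this
  have "calib (fst r) - calib (fst p) + m * (snd r - snd p - c * (\<tau> (Suc n) - \<tau> 0))
      - m\<^sup>2 / 2 * (\<tau> (Suc n) - \<tau> 0) \<le> action (L_a c) \<gamma> (\<tau> 0) (\<tau> (Suc n))" for m
    using split[of m] act q(4)[of m] r(3)[rule_format, of m] by linarith
  then show ?case
    using q(1) n(1) r(1) int by (intro exI[of _ r]) auto
qed

section \<open>The critical value\<close>

lemma emeasure_lborel_shift:
  fixes X :: "real set"
  assumes "X \<in> sets borel"
  shows "emeasure lborel ((\<lambda>y. y + s) -` X) = emeasure lborel X"
proof -
  have "emeasure lborel X = emeasure (distr lborel borel ((+) s)) X"
    by (simp only: lborel_distr_plus)
  also have "\<dots> = emeasure lborel ((+) s -` X)"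
    using assms by (subst emeasure_distr) auto
  also have "(+) s -` X = (\<lambda>y. y + s) -` X"
    by (auto simp: add.commute)
  finally show ?thesis ..
qed

text \<open>Rotation invariance of arc length. With r the fractional part of s, the unit interval is
  cut at 1 - r and its two pieces are translated onto [r, 1) and [0, r).\<close>

lemma emeasure_periodic_shift:
  fixes B :: "real set"
  assumes B: "B \<in> sets borel" and per: "\<And>y (k::int). y + of_int k \<in> B \<longleftrightarrow> y \<in> B"
  shows "emeasure lborel ({0..<1} \<inter> (\<lambda>y. y + s) -` B) = emeasure lborel ({0..<1} \<inter> B)"
proof -
  define r where "r = s - of_int \<lfloor>s\<rfloor>"
  have r: "0 \<le> r" "r < 1"
    unfolding r_def by linarith+
  have "y + s \<in> B \<longleftrightarrow> y + r \<in> B" for y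
    using per[of "y + r" "\<lfloor>s\<rfloor>"] by (simp add: r_def add.assoc)
  moreover have "y + r \<in> B \<longleftrightarrow> y + (r - 1) \<in> B" for y
    using per[of "y + (r - 1)" 1] by (simp add: algebra_simps)
  ultimately have "{0..<1} \<inter> (\<lambda>y. y + s) -` B =
      (\<lambda>y. y + r) -` ({r..<1} \<inter> B) \<union> (\<lambda>y. y + (r - 1)) -` ({0..<r} \<inter> B)"
    using r by (intro set_eqI) (auto simp: vimage_def)
  then have "emeasure lborel ({0..<1} \<inter> (\<lambda>y. y + s) -` B) =
      emeasure lborel ((\<lambda>y. y + r) -` ({r..<1} \<inter> B)) + emeasure lborel ((\<lambda>y. y + (r - 1)) -` ({0..<r} \<inter> B))"
    using B by (auto intro!: plus_emeasure[symmetric] measurable_sets_borel[of _ borel])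
  also have "\<dots> = emeasure lborel ({r..<1} \<inter> B) + emeasure lborel ({0..<r} \<inter> B)"
    using B by (intro arg_cong2[where f = plus] emeasure_lborel_shift) auto
  also have "\<dots> = emeasure lborel (({r..<1} \<inter> B) \<union> ({0..<r} \<inter> B))"
    using B by (intro plus_emeasure) auto
  also have "({r..<1} \<inter> B) \<union> ({0..<r} \<inter> B) = {0..<1} \<inter> B"
    using r by auto
  finally show ?thesis .
qed

section \<open>The minimizing invariant measure\<close>

lemma pend_equilibrium: "pend (0, 0) t = (0, 0)"
  using pend_unique[of "\<lambda>_. (0, 0)" t] by (simp add: pend_field_def zero_prod_def[symmetric])

lemma EL_flow_Gamma_a:
  "EL_flow (L_a c) t (ttorus_proj ((0, y), (0, c))) = ttorus_proj ((0, y + c * t), (0, c))"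
  unfolding EL_flow_L_a by (simp add: lift_flow_def pend_equilibrium)

definition Gamma_measure :: "real \<Rightarrow> ttorus measure" where
  "Gamma_measure c = distr (uniform_measure lborel {0..<1}) borel (\<lambda>y. ttorus_proj ((0, y), (0, c)))"

lemma measurable_Gamma_param [measurable]: "(\<lambda>y. ttorus_proj ((0, y), (0, c))) \<in> borel_measurable borel"
  by (intro borel_measurable_continuous_onI continuous_on_compose2[OF continuous_on_ttorus_proj])
    (auto intro!: continuous_intros)

lemma measurable_Gamma_param_uniform:
  "(\<lambda>y. ttorus_proj ((0, y), (0, c))) \<in> borel_measurable (uniform_measure lborel {0..<1})"
  using measurable_Gamma_param[of c] by (subst measurable_cong_sets[where M' = borel and N' = borel]) auto

text \<open>On the circle the flow is the rotation by c t, and the lift of any Borel set is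
  periodic, so invariance reduces to \<open>emeasure_periodic_shift\<close>.\<close>

lemma EL_invariant_Gamma_measure: "EL_invariant_measure (L_a c) (Gamma_measure c)"
  unfolding EL_invariant_measure_def
proof (intro conjI allI)
  show "prob_space (Gamma_measure c)"
    unfolding Gamma_measure_def
    by (intro prob_space.prob_space_distr prob_space_uniform_measure measurable_Gamma_param_uniform) auto
  show "sets (Gamma_measure c) = sets borel"
    by (simp add: Gamma_measure_def)
  fix t
  show flow [measurable]: "EL_flow (L_a c) t \<in> borel_measurable borel"
    by (intro borel_measurable_continuous_onI continuous_on_EL_flow)
  show "distr (Gamma_measure c) borel (EL_flow (L_a c) t) = Gamma_measure c"
  proof (rule measure_eqI)
    fix A assume "A \<in> sets (distr (Gamma_measure c) borel (EL_flow (L_a c) t))"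
    then have A: "A \<in> sets borel" by simp
    define B where "B = {y. ttorus_proj ((0, y), (0, c)) \<in> A}"
    have B: "B \<in> sets borel"
      using measurable_sets_borel[OF measurable_Gamma_param A, of c] by (simp add: B_def vimage_def)
    have vim: "(\<lambda>y. y + c * t) -` B \<in> sets borel"
      by (intro measurable_sets_borel[OF _ B]) auto
    have "emeasure (distr (Gamma_measure c) borel (EL_flow (L_a c) t)) A
        = emeasure (uniform_measure lborel {0..<1}) ((\<lambda>y. y + c * t) -` B)"
      unfolding Gamma_measure_def using A
      by (subst distr_distr) (auto simp: measurable_Gamma_param_uniform flow emeasure_distr B_def vimage_def EL_flow_Gamma_a simp del: ttorus_proj_Pair)
    also have "\<dots> = emeasure (uniform_measure lborel {0..<1}) B"
      using emeasure_periodic_shift[OF B, of "c * t"] B vim by (simp add: B_def)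
    also have "\<dots> = emeasure (Gamma_measure c) A"
      unfolding Gamma_measure_def using A
      by (subst emeasure_distr) (auto simp: measurable_Gamma_param_uniform B_def vimage_def simp del: ttorus_proj_Pair)
    finally show "emeasure (distr (Gamma_measure c) borel (EL_flow (L_a c) t)) A = emeasure (Gamma_measure c) A" .
  qed (simp add: Gamma_measure_def)
qed

text \<open>The value 0 is attained by \<open>Gamma_measure c\<close>, as the minimum requires, and
  nonnegativity of the Lagrangian excludes anything smaller.\<close>

lemma mane_critical_value_L_a: "mane_critical_value (L_a c) = 0"
proof -
  have L0: "L_a c (ttorus_proj ((0, y), (0, c))) = 0" for y
    by (simp add: L_a_eq_0_iff Gamma_a_def)
  have [measurable]: "L_a c \<in> borel_measurable borel"
    by (intro borel_measurable_continuous_onI continuous_on_L_a)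
  have "integrable (Gamma_measure c) (L_a c)"
    unfolding Gamma_measure_def by (subst integrable_distr_eq) (auto simp: measurable_Gamma_param_uniform L0 simp del: ttorus_proj_Pair)
  moreover have "(\<integral>z. L_a c z \<partial>Gamma_measure c) = 0"
    unfolding Gamma_measure_def by (subst integral_distr) (auto simp: measurable_Gamma_param_uniform L0 simp del: ttorus_proj_Pair)
  ultimately have "(LEAST r. \<exists>\<mu>. EL_invariant_measure (L_a c) \<mu> \<and> integrable \<mu> (L_a c) \<and> r = (\<integral>z. L_a c z \<partial>\<mu>)) = 0"
    using EL_invariant_Gamma_measure
    by (intro Least_equality) (metis, auto intro!: integral_nonneg_AE simp: L_a_nonneg)
  then show ?thesis
    by (simp add: mane_critical_value_def)
qed

section \<open>Hyperbolicity\<close>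

text \<open>The error of the linearization. A quadratic bound is enough to differentiate at the
  equilibrium.\<close>

lemma sin_minus_self_le: "\<bar>sin y - y\<bar> \<le> y\<^sup>2" for y :: real
proof -
  have "(\<Sum>m<2. sin_coeff m * y ^ m) = y"
    by (simp add: numeral_2_eq_2 sin_coeff_def)
  then have "\<bar>sin y - y\<bar> \<le> inverse (fact 2) * \<bar>y\<bar>\<^sup>2"
    using Maclaurin_sin_bound[of y 2] by simp
  also have "\<dots> \<le> y\<^sup>2"
    by (simp add: fact_2)
  finally show ?thesis .
qed

lemma has_derivative_zeroI:
  fixes f :: "'a::real_normed_vector \<Rightarrow> 'b::real_normed_vector"
  assumes "\<delta> > 0" and f: "\<And>u. norm u < \<delta> \<Longrightarrow> norm (f u) \<le> C * (norm u)\<^sup>2"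
  shows "(f has_derivative (\<lambda>_. 0)) (at 0)"
  unfolding has_derivative_at
proof
  have "f 0 = 0"
    using f[of 0] \<open>\<delta> > 0\<close> by simp
  have "(\<lambda>h. norm (f h) / norm h) \<midarrow>0\<rightarrow> 0"
  proof (rule Lim_null_comparison)
    show "(\<lambda>h::'a. C * norm h) \<midarrow>0\<rightarrow> 0"
      by (auto intro!: tendsto_eq_intros)
    have "\<forall>\<^sub>F h in at (0::'a). h \<in> ball 0 \<delta>"
      using \<open>\<delta> > 0\<close> by (intro eventually_at_in_open') auto
    then show "\<forall>\<^sub>F h in at (0::'a). norm (norm (f h) / norm h) \<le> C * norm h"
    proof (rule eventually_mono)
      fix h :: 'a
      assume "h \<in> ball 0 \<delta>"
      then show "norm (norm (f h) / norm h) \<le> C * norm h"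
        using f[of h] \<open>f 0 = 0\<close> by (cases "h = 0") (simp_all add: divide_le_eq power2_eq_square mult.assoc)
    qed
  qed
  then show "(\<lambda>h. norm (f (0 + h) - f 0 - 0) / norm h) \<midarrow>0\<rightarrow> 0"
    by (simp add: \<open>f 0 = 0\<close>)
qed simp

text \<open>The solution of the linearized equation x'' = 4 pi^2 x with initial position and
  velocity z.\<close>

definition pend_lin :: "real \<times> real \<Rightarrow> real \<Rightarrow> real \<times> real" where
  "pend_lin z t = (fst z * cosh (2 * pi * t) + snd z * sinh (2 * pi * t) / (2 * pi),
     fst z * (2 * pi) * sinh (2 * pi * t) + snd z * cosh (2 * pi * t))"

lemma pend_lin_deriv:
  "(pend_lin z has_vector_derivative (snd (pend_lin z t), 4 * pi\<^sup>2 * fst (pend_lin z t))) (at t)"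
proof -
  have "((\<lambda>t. fst z * cosh (2 * pi * t) + snd z * sinh (2 * pi * t) / (2 * pi)) has_real_derivative snd (pend_lin z t)) (at t)"
    "((\<lambda>t. fst z * (2 * pi) * sinh (2 * pi * t) + snd z * cosh (2 * pi * t)) has_real_derivative
      4 * pi\<^sup>2 * fst (pend_lin z t)) (at t)"
    by (auto intro!: derivative_eq_intros simp: pend_lin_def power2_eq_square field_simps)
  then show ?thesis
    unfolding pend_lin_def[abs_def] has_real_derivative_iff_has_vector_derivative
    by (rule has_vector_derivative_Pair)
qed

text \<open>The distance estimate against the equilibrium solution at the origin.\<close>

lemma pend_growth:
  assumes "0 \<le> t" "t \<le> T"
  shows "norm (pend z t) \<le> sqrt (exp ((2 * pend_lip + 1) * T)) * norm z"
proof -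
  have "(norm (pend z t))\<^sup>2 \<le> exp ((2 * pend_lip + 1) * \<bar>t\<bar>) * (norm z)\<^sup>2"
    using pend_dist[of z t "(0, 0)"] unfolding pend_equilibrium by (simp flip: zero_prod_def)
  also have "\<dots> \<le> exp ((2 * pend_lip + 1) * T) * (norm z)\<^sup>2"
    using assms pend_lip_pos by (intro mult_right_mono) auto
  finally show ?thesis
    using real_sqrt_le_mono by (fastforce simp: real_sqrt_mult)
qed

text \<open>The difference solves the linearized equation with forcing 2 pi (sin (2 pi x) - 2 pi x),
  at most 8 pi^3 x^2. Here |x| is at most M |z| with the growth factor M, and Gronwall contributes
  the third M. The bound is uniform up to T because the return time varies with the point.\<close>

lemma pend_linearization:
  assumes "0 \<le> t" "t \<le> T"
  shows "norm (pend z t - pend_lin z t) \<le> 8 * pi ^ 3 * sqrt (exp ((2 * pend_lip + 1) * T)) ^ 3 * (norm z)\<^sup>2"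
proof -
  define M where "M = sqrt (exp ((2 * pend_lip + 1) * T))"
  define R where "R = 8 * pi ^ 3 * (M * norm z)\<^sup>2"
  define D where "D = (\<lambda>s. pend z s - pend_lin z s)"
  define D' where "D' = (\<lambda>s. pend_field (pend z s) - (snd (pend_lin z s), 4 * pi\<^sup>2 * fst (pend_lin z s)))"
  have D: "(D has_vector_derivative D' s) (at s)" for s
    unfolding D_def D'_def by (intro has_vector_derivative_diff pend_deriv pend_lin_deriv)
  have "norm (D' s) \<le> pend_lip * norm (D s) + R" if "s \<in> {0..t}" for s
  proof -
    define x where "x = fst (pend z s)"
    have D': "D' s = (snd (D s), 4 * pi\<^sup>2 * fst (D s) + 2 * pi * (sin (2 * pi * x) - 2 * pi * x))"
      by (simp add: D'_def D_def pend_field_def x_def power2_eq_square algebra_simps)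
    have "norm (D' s) \<le> \<bar>snd (D s)\<bar> + \<bar>4 * pi\<^sup>2 * fst (D s) + 2 * pi * (sin (2 * pi * x) - 2 * pi * x)\<bar>"
      unfolding D' by (metis norm_Pair_le real_norm_def)
    also have "\<dots> \<le> \<bar>snd (D s)\<bar> + (\<bar>4 * pi\<^sup>2 * fst (D s)\<bar> + \<bar>2 * pi * (sin (2 * pi * x) - 2 * pi * x)\<bar>)"
      by (intro add_left_mono abs_triangle_ineq)
    also have "\<bar>snd (D s)\<bar> \<le> norm (D s)"
      using norm_snd_le[of "snd (D s)" "fst (D s)"] by simp
    also have "\<bar>4 * pi\<^sup>2 * fst (D s)\<bar> \<le> 4 * pi\<^sup>2 * norm (D s)"
      using norm_fst_le[of "fst (D s)" "snd (D s)"] by (simp add: abs_mult)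
    also have "\<bar>2 * pi * (sin (2 * pi * x) - 2 * pi * x)\<bar> \<le> 2 * pi * (2 * pi * x)\<^sup>2"
      unfolding abs_mult[of "2 * pi"] using sin_minus_self_le[of "2 * pi * x"] by simp
    also have "2 * pi * (2 * pi * x)\<^sup>2 = 8 * pi ^ 3 * \<bar>x\<bar>\<^sup>2"
      by (simp add: power2_eq_square power3_eq_cube)
    also have "\<dots> \<le> R"
    proof -
      have "\<bar>x\<bar> \<le> norm (pend z s)"
        using norm_fst_le[of "fst (pend z s)" "snd (pend z s)"] by (simp add: x_def)
      also have "\<dots> \<le> M * norm z"
        unfolding M_def using that assms by (intro pend_growth) auto
      finally show ?thesis
        unfolding R_def by (intro mult_left_mono power_mono) auto
    qed
    finally show ?thesis
      by (simp add: pend_lip_def algebra_simps)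
  qed
  \<comment> \<open>The difference vanishes at time 0, so only the forcing term remains on the
    right.\<close>
  from gronwall[OF \<open>0 \<le> t\<close> less_imp_le[OF pend_lip_pos] D this]
  have "(norm (D t))\<^sup>2 \<le> exp ((2 * pend_lip + 1) * t) * R\<^sup>2"
    by (simp add: D_def pend_lin_def) (smt (verit) zero_le_power2)
  also have "\<dots> \<le> exp ((2 * pend_lip + 1) * T) * R\<^sup>2"
    using assms pend_lip_pos by (intro mult_right_mono) auto
  also have "\<dots> = (M * R)\<^sup>2"
    by (simp add: M_def power_mult_distrib)
  finally have "norm (D t) \<le> M * R"
    by (rule power2_le_imp_le) (simp add: M_def R_def)
  also have "M * R = 8 * pi ^ 3 * M ^ 3 * (norm z)\<^sup>2"
    by (simp add: R_def power2_eq_square power3_eq_cube)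
  finally show ?thesis
    by (simp add: D_def M_def)
qed

text \<open>Conservation of the pendulum energy brings a returning orbit back onto the section: y'
  is constant along it and must again equal the value prescribed by the energy level.\<close>

lemma pend_energy: "(snd (pend z t))\<^sup>2 / 2 + cos (2 * pi * fst (pend z t)) = (snd z)\<^sup>2 / 2 + cos (2 * pi * fst z)"
proof -
  have "((\<lambda>t. (snd (pend z t))\<^sup>2 / 2 + cos (2 * pi * fst (pend z t))) has_real_derivative 0) (at t)" for t
  proof -
    have "((\<lambda>t. fst (pend z t)) has_real_derivative snd (pend z t)) (at t)"
      "((\<lambda>t. snd (pend z t)) has_real_derivative 2 * pi * sin (2 * pi * fst (pend z t))) (at t)"
      using bounded_linear.has_vector_derivative[OF bounded_linear_fst pend_deriv[of z t]]
        bounded_linear.has_vector_derivative[OF bounded_linear_snd pend_deriv[of z t]]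
      by (simp_all add: pend_field_def has_real_derivative_iff_has_vector_derivative)
    then show ?thesis
      by (auto intro!: derivative_eq_intros)
  qed
  then show ?thesis
    using DERIV_isconst_all[of "\<lambda>t. (snd (pend z t))\<^sup>2 / 2 + cos (2 * pi * fst (pend z t))" t 0] by simp
qed

text \<open>In the y-part the mixed term cancels: w (w - c) - (w - c)^2 / 2 = (w^2 - c^2) /
  2.\<close>

lemma energy_L_a:
  "energy (L_a c) (ttorus_proj ((x, y), (v, w))) = v\<^sup>2 / 2 - 1 + cos (2 * pi * x) + (w\<^sup>2 - c\<^sup>2) / 2"
proof -
  have "frechet_derivative (\<lambda>w. L_a c (torus_proj (x, y), w)) (at (v, w)) = (\<lambda>h. h \<bullet> (v, w - c))"
    using GDERIV_L_a_velocity[of c "torus_proj (x, y)" "(v, w)"] frechet_derivative_at unfolding gderiv_def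
    by (metis fst_conv snd_conv)
  moreover have "energy (L_a c) (ttorus_proj ((x, y), (v, w))) =
      frechet_derivative (\<lambda>w. L_a c (torus_proj (x, y), w)) (at (v, w)) (v, w) - L_a c (torus_proj (x, y), (v, w))"
    unfolding energy_def ttorus_proj_Pair by simp
  ultimately show ?thesis
    by (simp add: L_a_torus_proj power2_eq_square field_simps del: torus_proj_Pair)
qed

lemma EL_vector_L_a:
  "EL_vector (L_a c) (ttorus_proj Z) (snd Z, (2 * pi * sin (2 * pi * fst (fst Z)), 0))"
proof -
  have eq: "fst (ttorus_proj z) = torus_proj (fst z)" "snd (ttorus_proj z) = snd z" for z
    by (cases z; simp)+
  show ?thesis
    unfolding EL_vector_def EL_flow_L_a fst_conv snd_conv eq
    using has_velocity_torus_proj[OF lift_flow_fst_deriv[of Z 0]] lift_flow_snd_deriv[of Z 0] by simp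
qed

lemma periodic_orbit_Gamma_a:
  assumes "c \<noteq> 0"
  shows "periodic_orbit (L_a c) (ttorus_proj ((0, 0), (0, c))) (1 / \<bar>c\<bar>) (Gamma_a c)"
  unfolding periodic_orbit_def EL_flow_Gamma_a
proof (intro conjI ballI)
  show "ttorus_proj ((0, 0 + c * (1 / \<bar>c\<bar>)), (0, c)) = ttorus_proj ((0, 0), (0, c))"
    using assms by (simp add: circ_eq_iff abs_if)
  fix s assume s: "s \<in> {0<..<1 / \<bar>c\<bar>}"
  then have "0 < \<bar>c * s\<bar>" "\<bar>c * s\<bar> < 1"
    using assms by (auto simp: abs_mult field_simps)
  then have "c * s \<notin> \<int>"
    using Ints_nonzero_abs_less1[of "c * s"] by auto
  then show "ttorus_proj ((0, 0 + c * s), (0, c)) \<noteq> ttorus_proj ((0, 0), (0, c))"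
    by (simp add: circ_eq_iff)
next
  show "Gamma_a c = range (\<lambda>s. ttorus_proj ((0, 0 + c * s), (0, c)))"
  proof (intro subset_antisym subsetI)
    fix z assume "z \<in> Gamma_a c"
    then obtain q where "z = ((circ 0, q), (0, c))"
      by (auto simp: Gamma_a_def)
    then obtain y where "z = ttorus_proj ((0, 0 + c * (y / c)), (0, c))"
      using circ_surj[of q] assms by auto
    then show "z \<in> range (\<lambda>s. ttorus_proj ((0, 0 + c * s), (0, c)))"
      by blast
  qed (auto simp: Gamma_a_def)
qed (use assms in auto)

section \<open>The section, the return time and the return map\<close>

text \<open>
  On the section \<open>y = 0\<close> the energy of \<open>Gamma_a c\<close> determines \<open>\<bar>vy\<bar>\<close> as the square root of
  \<open>speed_sq\<close>.
\<close>

definition speed_sq :: "real \<Rightarrow> real^2 \<Rightarrow> real" where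
  "speed_sq c u = c\<^sup>2 - (u $ 2)\<^sup>2 + 2 * (1 - cos (2 * pi * u $ 1))"

text \<open>The first bound makes the section injective modulo integers, the second makes
  \<open>speed_sq\<close> positive.\<close>

definition section_dom :: "real \<Rightarrow> (real^2) set" where
  "section_dom c = {u. \<bar>u $ 1\<bar> < 1/2 \<and> \<bar>u $ 2\<bar> < \<bar>c\<bar>}"

text \<open>The sign of c selects the branch of the energy level that contains
  \<open>Gamma_a c\<close>.\<close>

definition poincare_section :: "real \<Rightarrow> real^2 \<Rightarrow> (real \<times> real) \<times> (real \<times> real)" where
  "poincare_section c u = ((u $ 1, 0), (u $ 2, sgn c * sqrt (speed_sq c u)))"

text \<open>The y-motion is uniform, so one turn of length 1 takes exactly this time.\<close>

definition return_time :: "real \<Rightarrow> real^2 \<Rightarrow> real" where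
  "return_time c u = 1 / sqrt (speed_sq c u)"

definition vec_of_pair :: "real \<times> real \<Rightarrow> real^2" where
  "vec_of_pair z = fst z *\<^sub>R axis 1 1 + snd z *\<^sub>R axis 2 1"

definition return_map :: "real \<Rightarrow> real^2 \<Rightarrow> real^2" where
  "return_map c u = vec_of_pair (pend (u $ 1, u $ 2) (return_time c u))"

lemma vec_of_pair_nth [simp]: "vec_of_pair z $ 1 = fst z" "vec_of_pair z $ 2 = snd z"
  by (simp_all add: vec_of_pair_def axis_def)

lemma bounded_linear_vec_of_pair: "bounded_linear vec_of_pair"
  unfolding vec_of_pair_def[abs_def]
  by (intro bounded_linear_add bounded_linear_compose[OF bounded_linear_scaleR_left] bounded_linear_fst bounded_linear_snd)

lemma speed_sq_pos: "u \<in> section_dom c \<Longrightarrow> speed_sq c u > 0"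
proof -
  assume "u \<in> section_dom c"
  then have "(u $ 2)\<^sup>2 < c\<^sup>2"
    by (simp add: section_dom_def power2_strict_mono)
  moreover have "0 \<le> 2 * (1 - cos (2 * pi * u $ 1))"
    by simp
  ultimately show ?thesis
    unfolding speed_sq_def by linarith
qed

lemma open_section_dom: "open (section_dom c)"
  unfolding section_dom_def by (intro open_Collect_conj open_Collect_less continuous_intros)

lemma speed_sq_deriv:
  "(speed_sq c has_derivative (\<lambda>h. - 2 * u $ 2 * h $ 2 + 4 * pi * sin (2 * pi * u $ 1) * h $ 1)) (at u)"
  unfolding speed_sq_def[abs_def]
  by (auto intro!: derivative_eq_intros bounded_linear.has_derivative[OF bounded_linear_vec_nth] simp: algebra_simps)

text \<open>Tangent vectors of the section have y-component 0, whereas the flow crosses it with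
  nonzero y-velocity. The derivative is injective because the parameters themselves appear as the
  coordinates x and vx.\<close>

lemma transversal_section_L_a:
  assumes "c \<noteq> 0"
  shows "transversal_section (L_a c) (ttorus_proj ((0, 0), (0, c))) (section_dom c) (poincare_section c)"
  unfolding transversal_section_def
proof (intro conjI ballI)
  show "open (section_dom c)"
    by (rule open_section_dom)
  show "0 \<in> section_dom c"
    using assms by (simp add: section_dom_def)
  show "ttorus_proj (poincare_section c 0) = ttorus_proj ((0, 0), (0, c))"
    by (simp add: poincare_section_def speed_sq_def sgn_mult_abs del: ttorus_proj_Pair)
  show "inj_on (ttorus_proj \<circ> poincare_section c) (section_dom c)"
  proof (rule inj_onI)
    fix u v :: "real^2"
    assume uv: "u \<in> section_dom c" "v \<in> section_dom c"
      and eq: "(ttorus_proj \<circ> poincare_section c) u = (ttorus_proj \<circ> poincare_section c) v"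
    then have "u $ 2 = v $ 2" "u $ 1 - v $ 1 \<in> \<int>"
      by (auto simp: poincare_section_def circ_eq_iff)
    moreover have "\<bar>u $ 1 - v $ 1\<bar> < 1"
      using uv by (auto simp: section_dom_def)
    ultimately have "u $ 1 = v $ 1"
      using Ints_nonzero_abs_less1[of "u $ 1 - v $ 1"] by simp
    with \<open>u $ 2 = v $ 2\<close> show "u = v"
      by (simp add: vec_eq_iff forall_2)
  qed
  show "energy (L_a c) (ttorus_proj (poincare_section c u)) = energy (L_a c) (ttorus_proj ((0, 0), (0, c)))"
    if "u \<in> section_dom c" for u
  proof -
    have "(sgn c * sqrt (speed_sq c u))\<^sup>2 = speed_sq c u"
      using speed_sq_pos[OF that] assms by (simp add: power_mult_distrib sgn_if)
    then show ?thesis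
      unfolding poincare_section_def energy_L_a by (simp add: speed_sq_def field_simps)
  qed
  let ?d = "\<lambda>u h. sgn c * ((- 2 * u $ 2 * h $ 2 + 4 * pi * sin (2 * pi * u $ 1) * h $ 1) * (inverse (sqrt (speed_sq c u)) / 2))"
  define \<sigma>' :: "real^2 \<Rightarrow> ((real^2) \<Rightarrow>\<^sub>L ((real \<times> real) \<times> (real \<times> real)))"
    where "\<sigma>' = (\<lambda>u. Blinfun (\<lambda>h. ((h $ 1, 0), (h $ 2, ?d u h))))"
  have "bounded_linear (\<lambda>h::real^2. ((h $ 1, 0::real), (h $ 2, ?d u h)))" for u
    by (intro bounded_linear_Pair bounded_linear_vec_nth bounded_linear_zero bounded_linear_const_mult
        bounded_linear_mult_const bounded_linear_add bounded_linear_compose[OF bounded_linear_const_mult])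
  then have \<sigma>': "blinfun_apply (\<sigma>' u) = (\<lambda>h. ((h $ 1, 0), (h $ 2, ?d u h)))" for u
    unfolding \<sigma>'_def by (rule bounded_linear_Blinfun_apply)
  show "\<exists>\<sigma>'. continuous_on (section_dom c) \<sigma>' \<and>
        (\<forall>u\<in>section_dom c. (poincare_section c has_derivative blinfun_apply (\<sigma>' u)) (at u) \<and>
               inj (blinfun_apply (\<sigma>' u)) \<and>
               (\<exists>X. EL_vector (L_a c) (ttorus_proj (poincare_section c u)) X \<and> X \<notin> range (blinfun_apply (\<sigma>' u))))"
  proof (intro exI[of _ \<sigma>'] conjI ballI)
    have cont: "continuous_on (section_dom c) (speed_sq c)"
      unfolding speed_sq_def[abs_def] by (intro continuous_intros)
    have nz: "\<forall>u\<in>section_dom c. sqrt (speed_sq c u) \<noteq> 0"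
      using speed_sq_pos[of _ c] by fastforce
    \<comment> \<open>In finite dimension, convergence of linear maps in operator norm can be
      checked on single vectors.\<close>
    have "continuous_on (section_dom c) (\<lambda>u. blinfun_apply (\<sigma>' u) h)" for h
      unfolding \<sigma>' by (intro continuous_intros cont nz) simp
    then show "continuous_on (section_dom c) \<sigma>'"
      unfolding continuous_on_def by (auto intro!: tendsto_componentwise1)
    fix u assume u: "u \<in> section_dom c"
    show "(poincare_section c has_derivative blinfun_apply (\<sigma>' u)) (at u)"
      unfolding \<sigma>' poincare_section_def[abs_def]
      using speed_sq_pos[OF u]
      by (auto intro!: derivative_eq_intros has_derivative_Pair speed_sq_deriv
          bounded_linear.has_derivative[OF bounded_linear_vec_nth] has_derivative_real_sqrt)
    show "inj (blinfun_apply (\<sigma>' u))"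
      by (auto simp: \<sigma>' inj_def vec_eq_iff forall_2)
    have "sgn c * sqrt (speed_sq c u) \<noteq> 0"
      using speed_sq_pos[OF u] assms by (simp add: sgn_if)
    then have "(snd (poincare_section c u), (2 * pi * sin (2 * pi * fst (fst (poincare_section c u))), 0))
        \<notin> range (blinfun_apply (\<sigma>' u))"
      by (auto simp: \<sigma>' poincare_section_def)
    then show "\<exists>X. EL_vector (L_a c) (ttorus_proj (poincare_section c u)) X \<and> X \<notin> range (blinfun_apply (\<sigma>' u))"
      using EL_vector_L_a by blast
  qed
qed

lemma speed_sq_return_map: "speed_sq c (return_map c u) = speed_sq c u"
  using pend_energy[of "(u $ 1, u $ 2)" "return_time c u"]
  by (simp add: return_map_def speed_sq_def field_simps)

text \<open>For |u2| below |c| / 2 the speed is at least |c| / 2. The resulting time 2 / |c| is the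
  fixed horizon of the growth estimates.\<close>

lemma return_time_bounds:
  assumes "c \<noteq> 0" "\<bar>u $ 2\<bar> < \<bar>c\<bar> / 2"
  shows "0 < return_time c u" "return_time c u \<le> 2 / \<bar>c\<bar>"
proof -
  have "(u $ 2)\<^sup>2 \<le> (c / 2)\<^sup>2"
    using assms by (intro abs_le_square_iff[THEN iffD1]) auto
  moreover have "0 \<le> 2 * (1 - cos (2 * pi * u $ 1))" "0 \<le> c\<^sup>2" "(c / 2)\<^sup>2 = c\<^sup>2 / 4" "(\<bar>c\<bar> / 2)\<^sup>2 = c\<^sup>2 / 4"
    by (auto simp: power_divide)
  ultimately have "(\<bar>c\<bar> / 2)\<^sup>2 \<le> speed_sq c u"
    unfolding speed_sq_def by linarith
  then have le: "\<bar>c\<bar> / 2 \<le> sqrt (speed_sq c u)"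
    by (rule real_le_rsqrt)
  have pos: "0 < \<bar>c\<bar> / 2"
    using assms by simp
  with le have "0 < sqrt (speed_sq c u)"
    by linarith
  then show "0 < return_time c u"
    by (simp add: return_time_def)
  have "1 / sqrt (speed_sq c u) \<le> 1 / (\<bar>c\<bar> / 2)"
    by (rule frac_le) (use le pos in auto)
  then show "return_time c u \<le> 2 / \<bar>c\<bar>"
    by (simp add: return_time_def)
qed

definition return_growth :: "real \<Rightarrow> real" where
  "return_growth c = sqrt (exp ((2 * pend_lip + 1) * (2 / \<bar>c\<bar>)))"

lemma return_growth_ge_1: "return_growth c \<ge> 1"
  using pend_lip_pos by (simp add: return_growth_def)

text \<open>Chosen so that a point and its image both stay within |x| < 1/2 and |vx| < |c| / 2:
  \<open>return_growth c\<close> bounds the growth up to the return, and the 2 comes from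
  \<open>norm_components_le\<close>.\<close>

definition return_radius :: "real \<Rightarrow> real" where
  "return_radius c = min (1/2) (\<bar>c\<bar> / 2) / (2 * return_growth c)"

lemma return_radius_pos: "c \<noteq> 0 \<Longrightarrow> return_radius c > 0"
  using return_growth_ge_1[of c] by (simp add: return_radius_def)

lemma norm_components_le: "norm (u $ 1, u $ 2) \<le> 2 * norm u" for u :: "real^2"
  using norm_Pair_le[of "u $ 1" "u $ 2"] component_le_norm_cart[of u 1] component_le_norm_cart[of u 2] by simp

lemma return_radius_D:
  assumes "c \<noteq> 0" "norm u < return_radius c"
  shows "\<bar>u $ 1\<bar> < 1/2" "\<bar>u $ 2\<bar> < \<bar>c\<bar> / 2"
    and "\<bar>return_map c u $ 1\<bar> < 1/2" "\<bar>return_map c u $ 2\<bar> < \<bar>c\<bar> / 2"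
proof -
  let ?M = "return_growth c" and ?m = "min (1/2) (\<bar>c\<bar> / 2)"
  have M: "?M > 0" "?M \<ge> 1"
    using return_growth_ge_1[of c] by auto
  have lt: "?M * (2 * norm u) < ?m"
    using assms(2) M by (simp add: return_radius_def pos_less_divide_eq mult_ac)
  moreover have "norm u \<le> ?M * (2 * norm u)"
    using mult_right_mono[OF M(2), of "2 * norm u"] norm_ge_zero[of u] by linarith
  ultimately have "norm u < ?m"
    by linarith
  then show u: "\<bar>u $ 1\<bar> < 1/2" "\<bar>u $ 2\<bar> < \<bar>c\<bar> / 2"
    using component_le_norm_cart[of u 1] component_le_norm_cart[of u 2] by auto
  let ?p = "pend (u $ 1, u $ 2) (return_time c u)"
  have "norm ?p \<le> ?M * norm (u $ 1, u $ 2)"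
    unfolding return_growth_def using return_time_bounds[OF assms(1) u(2)] by (intro pend_growth) auto
  also have "\<dots> \<le> ?M * (2 * norm u)"
    using M norm_components_le by (intro mult_left_mono) auto
  also note lt
  finally have "norm ?p < ?m" .
  then show "\<bar>return_map c u $ 1\<bar> < 1/2" "\<bar>return_map c u $ 2\<bar> < \<bar>c\<bar> / 2"
    using norm_fst_le[of "fst ?p" "snd ?p"] norm_snd_le[of "snd ?p" "fst ?p"]
    by (auto simp: return_map_def)
qed

lemma EL_flow_section:
  "EL_flow (L_a c) s (ttorus_proj (poincare_section c u)) =
    ttorus_proj ((fst (pend (u $ 1, u $ 2) s), sgn c * sqrt (speed_sq c u) * s),
      (snd (pend (u $ 1, u $ 2) s), sgn c * sqrt (speed_sq c u)))"
  unfolding EL_flow_L_a by (simp add: poincare_section_def lift_flow_def del: ttorus_proj_Pair)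

lemma poincare_map_L_a:
  assumes "c \<noteq> 0"
  shows "poincare_map (L_a c) (1 / \<bar>c\<bar>) (section_dom c) (poincare_section c) (return_map c)"
  unfolding poincare_map_def
proof (intro exI conjI ballI)
  let ?V = "ball 0 (return_radius c) :: (real^2) set"
  have V: "u \<in> section_dom c" "return_map c u \<in> section_dom c" "0 < return_time c u" if "u \<in> ?V" for u
    using return_radius_D[OF assms, of u] return_time_bounds[OF assms, of u] that
    by (auto simp: section_dom_def)
  show "open ?V" "0 \<in> ?V"
    using return_radius_pos[OF assms] by auto
  show "?V \<subseteq> section_dom c"
    using V by blast
  show "return_time c 0 = 1 / \<bar>c\<bar>"
    by (simp add: return_time_def speed_sq_def)
  have cont: "continuous_on ?V (speed_sq c)"
    unfolding speed_sq_def[abs_def] by (intro continuous_intros)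
  have "sqrt (speed_sq c u) \<noteq> 0" if "u \<in> ?V" for u
    using speed_sq_pos[OF V(1)[OF that]] by simp
  then show "continuous_on ?V (return_time c)"
    unfolding return_time_def[abs_def]
    by (intro continuous_on_divide continuous_on_const continuous_on_real_sqrt cont) blast
  fix u assume u: "u \<in> ?V"
  show "0 < return_time c u" "return_map c u \<in> section_dom c"
    using V u by blast+
  have pos: "sqrt (speed_sq c u) > 0"
    using speed_sq_pos[OF V(1)[OF u]] by simp
  have "circ (sgn c * sqrt (speed_sq c u) * return_time c u) = circ 0"
    using pos by (simp add: return_time_def circ_eq_iff sgn_if)
  then show "EL_flow (L_a c) (return_time c u) (ttorus_proj (poincare_section c u)) =
      ttorus_proj (poincare_section c (return_map c u))"
    unfolding EL_flow_section unfolding poincare_section_def speed_sq_return_map by (simp add: return_map_def)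
  fix s assume s: "s \<in> {0<..<return_time c u}"
  let ?y = "sgn c * sqrt (speed_sq c u) * s"
  have "\<bar>?y\<bar> = sqrt (speed_sq c u) * s"
    using s pos assms by (simp add: abs_mult abs_sgn_eq)
  moreover have "0 < sqrt (speed_sq c u) * s" "sqrt (speed_sq c u) * s < 1"
    using s pos by (auto simp: return_time_def field_simps)
  \<comment> \<open>Before the return time y has moved by a positive amount less than 1, so this is
    a first return.\<close>
  ultimately have "?y \<notin> \<int>"
    using Ints_nonzero_abs_less1[of ?y] by auto
  then have y: "circ ?y \<noteq> circ 0"
    by (simp add: circ_eq_iff)
  show "EL_flow (L_a c) s (ttorus_proj (poincare_section c u)) \<notin> (ttorus_proj \<circ> poincare_section c) ` section_dom c"
  proof
    assume "EL_flow (L_a c) s (ttorus_proj (poincare_section c u)) \<in> (ttorus_proj \<circ> poincare_section c) ` section_dom c"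
    then obtain v where "EL_flow (L_a c) s (ttorus_proj (poincare_section c u)) = ttorus_proj (poincare_section c v)"
      by (auto simp only: o_apply image_iff)
    then have "circ ?y = circ 0"
      unfolding EL_flow_section unfolding poincare_section_def by simp
    with y show False ..
  qed
qed

text \<open>Up to a quadratically small error the map is \<open>pend_lin\<close> at a variable time.
  This is linear in the initial position and velocity, which vanish at the centre, so the derivative
  of the return time drops out of the product rule.\<close>

lemma return_map_deriv:
  assumes "c \<noteq> 0"
  shows "(return_map c has_derivative (\<lambda>h. vec_of_pair (pend_lin (h $ 1, h $ 2) (1 / \<bar>c\<bar>)))) (at 0)"
proof -
  let ?T = "return_time c"
  let ?e = "\<lambda>u::real^2. pend (u $ 1, u $ 2) (?T u) - pend_lin (u $ 1, u $ 2) (?T u)"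
  define C where "C = 8 * pi ^ 3 * sqrt (exp ((2 * pend_lip + 1) * (2 / \<bar>c\<bar>))) ^ 3"
  have "norm (?e u) \<le> C * 4 * (norm u)\<^sup>2" if "norm u < return_radius c" for u
  proof -
    have "norm (?e u) \<le> C * (norm (u $ 1, u $ 2))\<^sup>2"
      unfolding C_def using return_time_bounds[OF assms return_radius_D(2)[OF assms that]]
      by (intro pend_linearization) auto
    also have "\<dots> \<le> C * (2 * norm u)\<^sup>2"
      using norm_components_le by (intro mult_left_mono power_mono) (auto simp: C_def)
    finally show ?thesis
      by (simp add: power_mult_distrib)
  qed
  then have e: "(?e has_derivative (\<lambda>_. 0)) (at 0)"
    by (rule has_derivative_zeroI[OF return_radius_pos[OF assms]])
  have T0: "?T 0 = 1 / \<bar>c\<bar>"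
    by (simp add: return_time_def speed_sq_def)
  obtain T' where T': "(?T has_derivative T') (at 0)"
  proof -
    have "speed_sq c 0 > 0"
      using assms by (simp add: speed_sq_def)
    then have "\<exists>T'. (?T has_derivative T') (at 0)"
      unfolding return_time_def[abs_def]
      by (auto intro!: exI derivative_eq_intros speed_sq_deriv has_derivative_real_sqrt)
    then show ?thesis
      using that by blast
  qed
  note vec_nth = bounded_linear.has_derivative[OF bounded_linear_vec_nth has_derivative_ident]
  have hyp: "((\<lambda>u. cosh (2 * pi * ?T u)) has_derivative (\<lambda>h. sinh (2 * pi * ?T 0) * (2 * pi * T' h))) (at 0)"
    "((\<lambda>u. sinh (2 * pi * ?T u)) has_derivative (\<lambda>h. cosh (2 * pi * ?T 0) * (2 * pi * T' h))) (at 0)"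
    using has_derivative_compose[OF has_derivative_mult_right[OF T', of "2 * pi"]
        has_field_derivative_cosh[OF DERIV_ident, unfolded has_field_derivative_def mult_1_right]]
      has_derivative_compose[OF has_derivative_mult_right[OF T', of "2 * pi"]
        has_field_derivative_sinh[OF DERIV_ident, unfolded has_field_derivative_def mult_1_right]]
    by auto
  have "((\<lambda>u::real^2. pend_lin (u $ 1, u $ 2) (?T u)) has_derivative
      (\<lambda>h. pend_lin (h $ 1, h $ 2) (1 / \<bar>c\<bar>))) (at 0)"
    unfolding pend_lin_def fst_conv snd_conv
    by (intro has_derivative_Pair; auto intro!: derivative_eq_intros vec_nth hyp simp: T0 fun_eq_iff)
  from has_derivative_add[OF this e]
  have "((\<lambda>u. pend (u $ 1, u $ 2) (?T u)) has_derivative (\<lambda>h. pend_lin (h $ 1, h $ 2) (1 / \<bar>c\<bar>))) (at 0)"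
    by simp
  then show ?thesis
    unfolding return_map_def[abs_def] by (rule bounded_linear.has_derivative[OF bounded_linear_vec_of_pair])
qed

text \<open>The rows (2 pi, 1) and (2 pi, -1) are left eigenvectors of the matrix, with eigenvalues
  cosh + sinh = exp (2 pi T) and cosh - sinh = exp (- 2 pi T). They cannot both annihilate a nonzero
  w, so k is one of these two numbers.\<close>

lemma return_map_deriv_eigenvalue:
  assumes "T > 0" "complex_eigenvalue (\<lambda>h::real^2. vec_of_pair (pend_lin (h $ 1, h $ 2) T)) k"
  shows "cmod k \<noteq> 1"
proof -
  let ?A = "\<lambda>h::real^2. vec_of_pair (pend_lin (h $ 1, h $ 2) T)"
  let ?C = "complex_of_real (cosh (2 * pi * T))" and ?S = "complex_of_real (sinh (2 * pi * T))"
  obtain w :: "complex^2" where "w \<noteq> 0"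
    and w: "(\<chi> i j. complex_of_real (matrix ?A $ i $ j)) *v w = k *s w"
    using assms(2) unfolding complex_eigenvalue_def by blast
  have "((\<chi> i j. complex_of_real (matrix ?A $ i $ j)) *v w) $ i = k * w $ i" for i
    by (simp add: w)
  from this[of 1] this[of 2]
  have 1: "?C * w $ 1 + ?S / (2 * pi) * w $ 2 = k * w $ 1"
    and 2: "2 * pi * ?S * w $ 1 + ?C * w $ 2 = k * w $ 2"
    by (simp_all add: matrix_vector_mult_def matrix_def sum_2 pend_lin_def axis_def)
  have S: "2 * pi * (?S / (2 * pi) * w $ 2) = ?S * w $ 2"
    by simp
  have "(?C + ?S) * (2 * pi * w $ 1 + w $ 2) = 2 * pi * (?C * w $ 1 + ?S / (2 * pi) * w $ 2) + (2 * pi * ?S * w $ 1 + ?C * w $ 2)"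
    unfolding distrib_left[of "_ * _" "_ * w $ 1"] S by (simp add: algebra_simps)
  then have plus: "(?C + ?S) * (2 * pi * w $ 1 + w $ 2) = k * (2 * pi * w $ 1 + w $ 2)"
    unfolding 1 2 by (simp add: algebra_simps)
  have "(?C - ?S) * (2 * pi * w $ 1 - w $ 2) = 2 * pi * (?C * w $ 1 + ?S / (2 * pi) * w $ 2) - (2 * pi * ?S * w $ 1 + ?C * w $ 2)"
    unfolding distrib_left[of "_ * _" "_ * w $ 1"] S by (simp add: algebra_simps)
  then have minus: "(?C - ?S) * (2 * pi * w $ 1 - w $ 2) = k * (2 * pi * w $ 1 - w $ 2)"
    unfolding 1 2 by (simp add: algebra_simps)
  have "2 * pi * w $ 1 + w $ 2 \<noteq> 0 \<or> 2 * pi * w $ 1 - w $ 2 \<noteq> 0"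
  proof (rule ccontr)
    assume "\<not> ?thesis"
    then have z: "2 * pi * w $ 1 + w $ 2 = 0" "2 * pi * w $ 1 - w $ 2 = 0"
      by auto
    have "2 * w $ 2 = (2 * pi * w $ 1 + w $ 2) - (2 * pi * w $ 1 - w $ 2)"
      by simp
    then have "w $ 2 = 0"
      unfolding z by simp
    with z(1) have "w $ 1 = 0"
      by simp
    with \<open>w $ 2 = 0\<close> \<open>w \<noteq> 0\<close> show False
      by (simp add: vec_eq_iff forall_2)
  qed
  then have "k = ?C + ?S \<or> k = ?C - ?S"
    using plus minus by auto
  then have "k = of_real (exp (2 * pi * T)) \<or> k = of_real (exp (- (2 * pi * T)))"
    by (simp only: cosh_plus_sinh cosh_minus_sinh flip: of_real_add of_real_diff)
  then show ?thesis
    using \<open>T > 0\<close> by auto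
qed

lemma hyperbolic_periodic_orbit_Gamma_a:
  assumes "c \<noteq> 0"
  shows "hyperbolic_periodic_orbit (L_a c) (Gamma_a c)"
  unfolding hyperbolic_periodic_orbit_def
proof (intro exI conjI allI impI)
  show "periodic_orbit (L_a c) (ttorus_proj ((0, 0), (0, c))) (1 / \<bar>c\<bar>) (Gamma_a c)"
    by (rule periodic_orbit_Gamma_a[OF assms])
  show "transversal_section (L_a c) (ttorus_proj ((0, 0), (0, c))) (section_dom c) (poincare_section c)"
    by (rule transversal_section_L_a[OF assms])
  show "poincare_map (L_a c) (1 / \<bar>c\<bar>) (section_dom c) (poincare_section c) (return_map c)"
    by (rule poincare_map_L_a[OF assms])
  show "(return_map c has_derivative (\<lambda>h. vec_of_pair (pend_lin (h $ 1, h $ 2) (1 / \<bar>c\<bar>)))) (at 0)"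
    by (rule return_map_deriv[OF assms])
  show "cmod k \<noteq> 1"
    if "complex_eigenvalue (\<lambda>h. vec_of_pair (pend_lin (h $ 1, h $ 2) (1 / \<bar>c\<bar>))) k" for k
    using return_map_deriv_eigenvalue[OF _ that] assms by simp
qed

section \<open>The Lax-Oleinik semigroup\<close>

definition u_init :: "torus \<Rightarrow> real" where
  "u_init q = calib_circle (fst q) + (1 - cos_circle (snd q))"

lemma continuous_on_u_init: "continuous_on UNIV u_init"
proof -
  have "continuous_on UNIV (\<lambda>q::torus. 2 / pi * (1 - sqrt ((1 + cos_circle (fst q)) / 2)) + (1 - cos_circle (snd q)))"
    by (intro continuous_intros continuous_on_compose2[OF continuous_on_cos_circle]) auto
  then show ?thesis
    by (simp add: u_init_def[abs_def] calib_circle_def)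
qed

lemma u_init_nonneg: "0 \<le> u_init q"
proof -
  obtain x where "q = torus_proj x"
    using torus_proj_surj by blast
  then show ?thesis
    by (cases x) (auto simp: u_init_def calib_def)
qed

lemma u_init_action_lower:
  assumes "t > 0" "piecewise_C1_path \<gamma> 0 t"
  shows "\<exists>y z. snd (\<gamma> t) = circ y \<and>
    calib_circle (fst (\<gamma> t)) + (1 - cos (2 * pi * z)) + (y - z - c * t)\<^sup>2 / (2 * t)
      \<le> u_init (\<gamma> 0) + action (L_a c) \<gamma> 0 t"
proof -
  obtain n \<tau> where \<tau>: "\<tau> 0 = 0" "\<tau> n = t"
    "\<forall>i<n. \<tau> i < \<tau> (Suc i) \<and> C1_curve_on {\<tau> i..\<tau> (Suc i)} \<gamma>"
    using assms(2) unfolding piecewise_C1_path_def by blast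
  obtain p where p: "\<gamma> 0 = torus_proj p"
    using torus_proj_surj by blast
  then obtain q where q: "\<gamma> t = torus_proj q"
    "\<forall>m. calib (fst q) - calib (fst p) + m * (snd q - snd p - c * t) - m\<^sup>2 / 2 * t
      \<le> action (L_a c) \<gamma> 0 t"
    using piecewise_C1_action_bound[OF \<tau>(3), of p c] \<tau> by auto
  \<comment> \<open>The maximizer of m r - m^2 t / 2 for the phase shift r; it is the mean excess of
    the y-velocity over c.\<close>
  define m where "m = (snd q - snd p - c * t) / t"
  have "m * (snd q - snd p - c * t) - m\<^sup>2 / 2 * t = (snd q - snd p - c * t)\<^sup>2 / (2 * t)"
    using \<open>t > 0\<close> by (simp add: m_def power2_eq_square)
  then have "calib (fst q) - calib (fst p) + (snd q - snd p - c * t)\<^sup>2 / (2 * t) \<le> action (L_a c) \<gamma> 0 t"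
    using q(2)[rule_format, of m] by linarith
  moreover have "u_init (\<gamma> 0) = calib (fst p) + (1 - cos (2 * pi * snd p))"
    by (cases p) (simp add: u_init_def p)
  moreover have "snd (\<gamma> t) = circ (snd q)" "calib_circle (fst (\<gamma> t)) = calib (fst q)"
    by (cases q; simp add: q)+
  ultimately show ?thesis
    by (intro exI[of _ "snd q"] exI[of _ "snd p"]) simp
qed

text \<open>The competitor attains equality in the x-part of the lower bound by following x' = 2 sin
  (pi x). In y it starts at an integer, where 1 - cos (2 pi y) vanishes, and moves
  uniformly.\<close>

lemma u_init_action_upper:
  assumes "t > 0"
  shows "\<exists>\<gamma>. piecewise_C1_path \<gamma> 0 t \<and> \<gamma> t = q \<and>
    u_init (\<gamma> 0) + action (L_a c) \<gamma> 0 t \<le> calib_circle (fst q) + 1 / (2 * t)"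
proof -
  obtain x where x: "\<bar>x\<bar> \<le> 1/2" "fst q = circ x"
    using circ_in_unit_interval by blast
  obtain y where y: "snd q = circ y"
    using circ_surj by blast
  \<comment> \<open>The shift in [0, 1] for which the starting point y - c t - d is an
    integer.\<close>
  define d where "d = y - c * t - of_int \<lfloor>y - c * t\<rfloor>"
  have d: "0 \<le> d" "d \<le> 1"
    unfolding d_def by linarith+
  \<comment> \<open>The substitution w = tan (pi x / 2) turns x' = 2 sin (pi x) into w' = 2 pi w,
    solved here with the prescribed value at time t.\<close>
  define w where "w = (\<lambda>s. exp (2 * pi * (s - t)) * tan (pi * x / 2))"
  define \<xi> where "\<xi> = (\<lambda>s. 2 / pi * arctan (w s))"
  have x4: "\<bar>pi * x / 2\<bar> \<le> pi / 4"
    using x(1) by (simp add: abs_mult)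
  have tan_le: "\<bar>tan (pi * x / 2)\<bar> \<le> 1"
  proof -
    have "tan (- (pi / 4)) \<le> tan (pi * x / 2)" "tan (pi * x / 2) \<le> tan (pi / 4)"
      by (rule tan_mono_le; use x4 pi_gt_zero in linarith)+
    then show ?thesis
      by (simp add: tan_45 abs_le_iff)
  qed
  have \<xi>t: "\<xi> t = x"
  proof -
    have "arctan (tan (pi * x / 2)) = pi * x / 2"
      by (rule arctan_tan; use x4 pi_gt_zero in linarith)
    then have "\<xi> t = 2 / pi * (pi * x / 2)"
      by (simp only: \<xi>_def w_def diff_self mult_zero_right exp_zero mult_1)
    then show ?thesis
      by simp
  qed
  \<comment> \<open>The factor exp (- 2 pi t) is at most 1, so the starting point lies in
    [-1/2, 1/2] as x does.\<close>
  have \<xi>0: "\<bar>\<xi> 0\<bar> \<le> 1/2"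
  proof -
    have "\<bar>w 0\<bar> \<le> 1 * 1"
      unfolding w_def abs_mult using tan_le \<open>t > 0\<close> by (intro mult_mono) auto
    then have "\<bar>arctan (w 0)\<bar> \<le> pi / 4"
      using arctan_monotone'[of "w 0" 1] arctan_monotone'[of "-1" "w 0"]
      by (simp add: arctan_minus arctan_one abs_le_iff)
    then show ?thesis
      by (simp add: \<xi>_def abs_mult field_simps)
  qed
  have sin_\<xi>: "2 * sin (pi * \<xi> s) = 4 * w s / (1 + (w s)\<^sup>2)" for s
  proof -
    have "sin (pi * \<xi> s) = 2 * sin (arctan (w s)) * cos (arctan (w s))"
      unfolding sin_double[symmetric] by (simp add: \<xi>_def)
    also have "\<dots> = 2 * w s / (1 + (w s)\<^sup>2)"
      by (simp add: sin_arctan cos_arctan)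
    finally show ?thesis by simp
  qed
  have \<xi>: "(\<xi> has_real_derivative 2 * sin (pi * \<xi> s)) (at s)" for s
  proof -
    have "(w has_real_derivative 2 * pi * w s) (at s)"
      unfolding w_def by (auto intro!: derivative_eq_intros)
    then have "(\<xi> has_real_derivative 2 / pi * (inverse (1 + (w s)\<^sup>2) * (2 * pi * w s))) (at s)"
      unfolding \<xi>_def by (intro DERIV_cmult DERIV_chain2[OF DERIV_arctan])
    moreover have "2 / pi * (inverse (1 + (w s)\<^sup>2) * (2 * pi * w s)) = 2 * sin (pi * \<xi> s)"
      unfolding sin_\<xi> by (simp add: divide_inverse)
    ultimately show ?thesis
      by (simp only:)
  qed
  define g where "g = (\<lambda>s. (\<xi> s, y + (c + d / t) * (s - t)))"
  define v where "v = (\<lambda>s. (2 * sin (pi * \<xi> s), c + d / t))"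
  have g: "(g has_vector_derivative v s) (at s)" for s
  proof -
    have "((\<lambda>s. y + (c + d / t) * (s - t)) has_real_derivative c + d / t) (at s)"
      by (auto intro!: derivative_eq_intros)
    then show ?thesis
      unfolding g_def v_def using \<xi>[of s]
      by (intro has_vector_derivative_Pair) (simp_all add: has_real_derivative_iff_has_vector_derivative)
  qed
  have cont: "continuous_on UNIV v"
    unfolding v_def using \<xi>
    by (intro continuous_intros) (meson DERIV_isCont continuous_at_imp_continuous_on)
  \<comment> \<open>Along this curve the x-part of the Lagrangian is 4 sin^2 (pi x), the derivative
    of - (2 / pi) cos (pi x).\<close>
  define A where "A = (\<lambda>s. - (2 / pi) * cos (pi * \<xi> s) + (d / t)\<^sup>2 / 2 * s)"
  have "((\<lambda>s. L_a c (torus_proj (g s), v s)) has_integral (A t - A 0)) {0..t}"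
  proof (rule fundamental_theorem_of_calculus)
    fix s
    have "L_a c (torus_proj (g s), v s) = (2 * sin (pi * \<xi> s)) * (2 * sin (pi * \<xi> s)) + (d / t)\<^sup>2 / 2"
      unfolding L_a_torus_proj g_def v_def
      using cos_double_sin[of "pi * \<xi> s"] by (simp add: power2_eq_square mult.assoc)
    moreover have "(A has_real_derivative (2 * sin (pi * \<xi> s)) * (2 * sin (pi * \<xi> s)) + (d / t)\<^sup>2 / 2) (at s)"
      unfolding A_def by (auto intro!: derivative_eq_intros \<xi>)
    ultimately show "(A has_vector_derivative L_a c (torus_proj (g s), v s)) (at s within {0..t})"
      by (simp add: has_real_derivative_iff_has_vector_derivative has_vector_derivative_at_within)
  qed (use \<open>t > 0\<close> in auto)
  then have act: "action (L_a c) (\<lambda>s. torus_proj (g s)) 0 t = A t - A 0"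
    unfolding action_torus_proj[OF g] by (rule integral_unique)
  \<comment> \<open>Without the absolute value, the x-part of the action is exactly the increment of
    \<open>calib\<close>.\<close>
  have calib: "calib z = 2 / pi * (1 - cos (pi * z))" if "\<bar>z\<bar> \<le> 1/2" for z
  proof -
    have "\<bar>pi * z\<bar> \<le> pi * (1/2)"
      unfolding abs_mult using that by (intro mult_mono) auto
    then have "0 \<le> cos (pi * z)"
      by (intro cos_ge_zero) linarith+
    then show ?thesis
      by (simp add: calib_def)
  qed
  have "y - (c + d / t) * t = of_int \<lfloor>y - c * t\<rfloor>"
    using \<open>t > 0\<close> by (simp add: d_def distrib_right)
  then have "snd (g 0) = of_int \<lfloor>y - c * t\<rfloor>"
    by (simp add: g_def)
  moreover have "u_init (torus_proj (g 0)) = calib (fst (g 0)) + (1 - cos (2 * pi * snd (g 0)))"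
    by (cases "g 0") (simp add: u_init_def)
  moreover have "fst (g 0) = \<xi> 0"
    by (simp add: g_def)
  ultimately have "u_init (torus_proj (g 0)) = calib (\<xi> 0)"
    by (simp only: cos_int_2pin)
  moreover have "A t - A 0 = 2 / pi * (cos (pi * \<xi> 0) - cos (pi * x)) + d\<^sup>2 / (2 * t)"
    using \<open>t > 0\<close> by (simp add: A_def \<xi>t power2_eq_square field_simps)
  moreover have "d\<^sup>2 / (2 * t) \<le> 1 / (2 * t)"
    using d \<open>t > 0\<close> by (intro divide_right_mono) (auto simp: power_le_one)
  ultimately have "u_init (torus_proj (g 0)) + action (L_a c) (\<lambda>s. torus_proj (g s)) 0 t
      \<le> calib_circle (fst q) + 1 / (2 * t)"
    unfolding act x(2) calib_circle_circ calib[OF x(1)] calib[OF \<xi>0] by (simp add: right_diff_distrib)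
  moreover have "torus_proj (g t) = q"
    by (simp add: g_def \<xi>t x y prod_eq_iff)
  moreover have "piecewise_C1_path (\<lambda>s. torus_proj (g s)) 0 t"
    by (rule piecewise_C1_path_torus_proj[OF g cont \<open>t > 0\<close>])
  ultimately show ?thesis
    by (intro exI[of _ "\<lambda>s. torus_proj (g s)"]) auto
qed

section \<open>Bounds on the semigroup and the rate of convergence\<close>

lemma lax_oleinik_u_init_upper:
  assumes "t > 0"
  shows "lax_oleinik (L_a c) t u_init q \<le> calib_circle (fst q) + 1 / (2 * t)"
proof -
  obtain \<gamma> where \<gamma>: "piecewise_C1_path \<gamma> 0 t" "\<gamma> t = q"
    "u_init (\<gamma> 0) + action (L_a c) \<gamma> 0 t \<le> calib_circle (fst q) + 1 / (2 * t)"
    using u_init_action_upper[OF assms] by blast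
  have "bdd_below {u_init (\<gamma> 0) + action (L_a c) \<gamma> 0 t | \<gamma>. piecewise_C1_path \<gamma> 0 t \<and> \<gamma> t = q}"
    by (intro bdd_belowI[of _ 0]) (blast intro: add_nonneg_nonneg action_nonneg u_init_nonneg)
  then have "lax_oleinik (L_a c) t u_init q \<le> u_init (\<gamma> 0) + action (L_a c) \<gamma> 0 t"
    unfolding lax_oleinik_def using \<gamma> by (intro cInf_lower) auto
  then show ?thesis
    using \<gamma>(3) by simp
qed

text \<open>The bound b is a parameter because it is used with 0 for the limit and with 1 / (32 t)
  for the rate.\<close>

lemma lax_oleinik_u_init_lower:
  assumes "t > 0"
    and b: "\<And>y z. snd q = circ y \<Longrightarrow> b \<le> (1 - cos (2 * pi * z)) + (y - z - c * t)\<^sup>2 / (2 * t)"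
  shows "calib_circle (fst q) + b \<le> lax_oleinik (L_a c) t u_init q"
  unfolding lax_oleinik_def
proof (rule cInf_greatest)
  show "{u_init (\<gamma> 0) + action (L_a c) \<gamma> 0 t | \<gamma>. piecewise_C1_path \<gamma> 0 t \<and> \<gamma> t = q} \<noteq> {}"
    using u_init_action_upper[OF assms(1), of q c] by blast
  fix r assume "r \<in> {u_init (\<gamma> 0) + action (L_a c) \<gamma> 0 t | \<gamma>. piecewise_C1_path \<gamma> 0 t \<and> \<gamma> t = q}"
  then obtain \<gamma> where \<gamma>: "r = u_init (\<gamma> 0) + action (L_a c) \<gamma> 0 t" "piecewise_C1_path \<gamma> 0 t" "\<gamma> t = q"
    by blast
  obtain y z where "snd q = circ y"
    "calib_circle (fst q) + (1 - cos (2 * pi * z)) + (y - z - c * t)\<^sup>2 / (2 * t) \<le> r"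
    using u_init_action_lower[OF assms(1) \<gamma>(2), of c] \<gamma> by blast
  then show "calib_circle (fst q) + b \<le> r"
    using b[of y z] by linarith
qed

lemma lax_oleinik_u_init_bounds:
  assumes "t > 0"
  shows "\<bar>lax_oleinik (L_a c) t u_init q - calib_circle (fst q)\<bar> \<le> 1 / (2 * t)"
proof -
  have "calib_circle (fst q) + 0 \<le> lax_oleinik (L_a c) t u_init q"
    using assms by (intro lax_oleinik_u_init_lower) auto
  then show ?thesis
    using lax_oleinik_u_init_upper[OF assms, of c q] by simp
qed

lemma uniform_limit_lax_oleinik:
  "uniform_limit UNIV (\<lambda>t. lax_oleinik (L_a c) t u_init) (\<lambda>q. calib_circle (fst q)) at_top"
proof (rule uniform_limitI)
  fix e :: real
  assume "e > 0"
  show "\<forall>\<^sub>F t in at_top. \<forall>q\<in>UNIV. dist (lax_oleinik (L_a c) t u_init q) (calib_circle (fst q)) < e"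
  proof (rule eventually_mono[OF eventually_gt_at_top[of "1 / e"]], intro ballI)
    fix t q assume t: "1 / e < t"
    then have "0 < t"
      using \<open>e > 0\<close> by (meson less_trans zero_less_divide_1_iff)
    moreover from this have "1 / (2 * t) < e"
      using t \<open>e > 0\<close> by (simp add: field_simps)
    ultimately show "dist (lax_oleinik (L_a c) t u_init q) (calib_circle (fst q)) < e"
      using lax_oleinik_u_init_bounds[of t c q] by (simp add: dist_real_def)
  qed
qed

text \<open>With c t an integer and final phase 1/2, a shift above 1/4 costs at least (1/4)^2 / (2
  t) = 1 / (32 t). A smaller shift means a start within 1/4 of phase 1/2, where the initial value is
  at least 1.\<close>

lemma lax_oleinik_rate:
  assumes "t \<ge> 1" and "c * t \<in> \<int>"
  shows "1 / 32 / t \<le> \<bar>lax_oleinik (L_a c) t u_init (circ 0, circ (1/2)) - calib_circle (circ 0)\<bar>"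
proof -
  have "1 / 32 / t \<le> (1 - cos (2 * pi * z)) + (y - z - c * t)\<^sup>2 / (2 * t)" if "circ (1/2) = circ y" for y z
  proof (cases "\<bar>y - z - c * t\<bar> \<le> 1/4")
    case False
    then have "(1/4)\<^sup>2 \<le> (y - z - c * t)\<^sup>2"
      by (simp add: abs_le_square_iff[symmetric])
    then have "1 / 32 / t \<le> (y - z - c * t)\<^sup>2 / (2 * t)"
      using \<open>t \<ge> 1\<close> by (simp add: field_simps power2_eq_square)
    then show ?thesis
      using cos_le_one[of "2 * pi * z"] by linarith
  next
    case True
    have "1/2 - y + c * t \<in> \<int>"
      using that assms(2) by (auto simp: circ_eq_iff)
    then obtain k :: int where k: "1/2 - y + c * t = of_int k"
      by (auto elim: Ints_cases)
    define r where "r = y - z - c * t"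
    have "z = 1/2 - r - of_int k"
      using k by (simp add: r_def)
    then have "2 * pi * z = pi - 2 * pi * r - 2 * pi * of_int k"
      by (simp only: right_diff_distrib)
    then have "cos (2 * pi * z) = cos (pi - 2 * pi * r - 2 * pi * of_int k)"
      by simp
    also have "\<dots> = - cos (2 * pi * r)"
      by (simp add: cos_diff[of "pi - _"] cos_int_2pin sin_int_2pin)
    finally have "cos (2 * pi * z) = - cos (2 * pi * r)" .
    moreover have "\<bar>2 * pi * r\<bar> \<le> 2 * pi * (1/4)"
      using True unfolding r_def abs_mult by (intro mult_mono) auto
    then have "0 \<le> cos (2 * pi * r)"
      by (intro cos_ge_zero) linarith+
    ultimately have "1 \<le> 1 - cos (2 * pi * z)"
      by simp
    \<comment> \<open>Here \<open>t \<ge> 1\<close> enters: the claimed bound is then below the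
      initial value alone.\<close>
    moreover have "1 / 32 / t \<le> 1" "0 \<le> (y - z - c * t)\<^sup>2 / (2 * t)"
      using \<open>t \<ge> 1\<close> by auto
    ultimately show ?thesis
      by linarith
  qed
  then have "calib_circle (circ 0) + 1 / 32 / t \<le> lax_oleinik (L_a c) t u_init (circ 0, circ (1/2))"
    using lax_oleinik_u_init_lower[of t "(circ 0, circ (1/2))" "1 / 32 / t" c] \<open>t \<ge> 1\<close> by simp
  then show ?thesis
    by linarith
qed

text \<open>The negated clause makes precise that no rate better than 1 / t is possible: an o(1 / t)
  majorant would contradict the lower bound along the sequence.\<close>

lemma lax_oleinik_slow_convergence:
  "\<exists>(u :: torus \<Rightarrow> real) u_bar.
       continuous_on UNIV u \<and>
       uniform_limit UNIV (\<lambda>t. lax_oleinik (L_a c) t u) u_bar at_top \<and>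
       (\<exists>(q0 :: torus) (t :: nat \<Rightarrow> real).
          (\<forall>n. t n \<ge> 0) \<and> filterlim t at_top sequentially \<and>
          (\<exists>C>0. \<forall>\<^sub>F n in sequentially.
             \<bar>lax_oleinik (L_a c) (t n) u q0 - u_bar q0\<bar> \<ge> C / t n)) \<and>
       \<not> (\<exists>r. r \<in> o[at_top](\<lambda>t::real. 1 / t) \<and>
            (\<forall>\<^sub>F t in at_top. \<forall>q. \<bar>lax_oleinik (L_a c) t u q - u_bar q\<bar> \<le> r t))"
proof -
  let ?T = "\<lambda>t. lax_oleinik (L_a c) t u_init"
  let ?q = "(circ 0, circ (1/2))"
  \<comment> \<open>At integer multiples of a the rotation has returned to its initial phase. For c
    = 0 every time has this property.\<close>
  define a where "a = (if c = 0 then 1 else 1 / \<bar>c\<bar>)"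
  define t where "t = (\<lambda>n. a * real n)"
  have "a > 0"
    by (simp add: a_def)
  have "filterlim t at_top sequentially"
    unfolding t_def
    by (rule filterlim_tendsto_pos_mult_at_top[OF tendsto_const \<open>a > 0\<close> filterlim_real_sequentially])
  have "c * t n \<in> \<int>" for n
    by (auto simp: t_def a_def abs_if)
  moreover have "\<forall>\<^sub>F n in sequentially. 1 \<le> t n"
    using \<open>filterlim t at_top sequentially\<close> by (simp add: filterlim_at_top)
  ultimately have rate: "\<forall>\<^sub>F n in sequentially. 1 / 32 / t n \<le> \<bar>?T (t n) ?q - calib_circle (fst ?q)\<bar>"
    using lax_oleinik_rate by (auto elim!: eventually_mono)
  have "\<not> (\<exists>r. r \<in> o[at_top](\<lambda>t::real. 1 / t) \<and>
            (\<forall>\<^sub>F t in at_top. \<forall>q. \<bar>?T t q - calib_circle (fst q)\<bar> \<le> r t))"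
  proof
    assume "\<exists>r. r \<in> o[at_top](\<lambda>t::real. 1 / t) \<and>
            (\<forall>\<^sub>F t in at_top. \<forall>q. \<bar>?T t q - calib_circle (fst q)\<bar> \<le> r t)"
    then obtain r where r: "r \<in> o[at_top](\<lambda>t::real. 1 / t)"
      "\<forall>\<^sub>F t in at_top. \<forall>q. \<bar>?T t q - calib_circle (fst q)\<bar> \<le> r t" by blast
    \<comment> \<open>Half of 1/32, so that the two estimates exclude each other at any positive
      time.\<close>
    have "\<forall>\<^sub>F t in at_top. \<bar>r t\<bar> \<le> 1 / 64 * \<bar>1 / t\<bar>"
      using landau_o.smallD[OF r(1), of "1/64"] by simp
    then have "\<forall>\<^sub>F t in at_top. \<bar>?T t ?q - calib_circle (fst ?q)\<bar> \<le> 1 / 64 * \<bar>1 / t\<bar>"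
      using r(2) by eventually_elim (metis abs_ge_self order_trans)
    then have "\<forall>\<^sub>F n in sequentially. \<bar>?T (t n) ?q - calib_circle (fst ?q)\<bar> \<le> 1 / 64 * \<bar>1 / t n\<bar>"
      using \<open>filterlim t at_top sequentially\<close> by (rule eventually_compose_filterlim)
    with rate have "\<forall>\<^sub>F n in sequentially. False"
      using \<open>\<forall>\<^sub>F n in sequentially. 1 \<le> t n\<close>
    proof eventually_elim
      case (elim n)
      then have "1 / 32 / t n \<le> 1 / 64 * \<bar>1 / t n\<bar>"
        by linarith
      then show False
        using elim(3) by (simp add: field_simps)
    qed
    then show False
      by simp
  qed
  moreover have "\<forall>n. t n \<ge> 0"
    using \<open>a > 0\<close> by (simp add: t_def)
  moreover have "\<exists>C>0. \<forall>\<^sub>F n in sequentially. C / t n \<le> \<bar>?T (t n) ?q - calib_circle (fst ?q)\<bar>"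
    using rate by (intro exI[of _ "1/32"]) simp
  ultimately show ?thesis
    using continuous_on_u_init uniform_limit_lax_oleinik[of c] \<open>filterlim t at_top sequentially\<close> by blast
qed

theorem mainTheorem2:
  fixes c :: real
  shows "mane_critical_value (L_a c) = 0 \<and>
    (c \<noteq> 0 \<longrightarrow> hyperbolic_periodic_orbit (L_a c) (Gamma_a c)) \<and>
    aubry_set (L_a c) = Gamma_a c \<and>
    (\<exists>(u :: torus \<Rightarrow> real) u_bar.
       continuous_on UNIV u \<and>
       uniform_limit UNIV (\<lambda>t. lax_oleinik (L_a c) t u) u_bar at_top \<and>
       (\<exists>(q0 :: torus) (t :: nat \<Rightarrow> real).
          (\<forall>n. t n \<ge> 0) \<and> filterlim t at_top sequentially \<and>
          (\<exists>C>0. \<forall>\<^sub>F n in sequentially.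
             \<bar>lax_oleinik (L_a c) (t n) u q0 - u_bar q0\<bar> \<ge> C / t n)) \<and>
       \<not> (\<exists>r. r \<in> o[at_top](\<lambda>t::real. 1 / t) \<and>
            (\<forall>\<^sub>F t in at_top. \<forall>q. \<bar>lax_oleinik (L_a c) t u q - u_bar q\<bar> \<le> r t)))"
  by (intro conjI impI mane_critical_value_L_a hyperbolic_periodic_orbit_Gamma_a aubry_set_L_a
      lax_oleinik_slow_convergence)

end
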